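(* Let $L$ be an oriented link. For every $i\in\mathbb{Z}$ there is an isomorphism of $\mathbb{F}_2$-vector spaces $$\mathrm{BN}_s^i(L)\cong\mathrm{BN}^i(L)'$$ between the stable Bar-Natan homology and the filtered ($u=1$) Bar-Natan homology of $L$.
   Context: Let $D$ be a diagram of $L$ with $n$ ordered crossings, $n_+$ positive and $n_-$ negative. For $\alpha\in\{0,1\}^n$ let $D_\alpha$ be the complete smoothing in which the $r$-th crossing receives its $\alpha_r$-smoothing (the oriented smoothing of a positive crossing is its 0-smoothing and of a negative crossing its 1-smoothing). Let $A=\mathbb{F}_2\{1,x\}$ with $\deg 1=1$, $\deg x=-1$, and $V_\alpha=A^{\otimes(\text{circles of }D_\alpha)}$. Set $\overline{\mathcal C}^{i}=\bigoplus_{|\alpha|-n_-=i}V_\alpha$, where $|\alpha|$ is the number of 1's in $\alpha$, and give homogeneous $v\in V_\alpha\subset\overline{\mathcal C}^{i}$ the $q$-grading $q(v)=\deg(v)+i+n_+-n_-$. Graded Bar-Natan theory: $\mathcal C^{*}=\overline{\mathcal C}^{*}\otimes_{\mathbb{F}_2}\mathbb{F}_2[u]$ with $u$ of bidegree $(0,-2)$. The $\mathbb{F}_2[u]$-linear differential $d$ is, on the summand of $\alpha$, the sum over all edges $\alpha\to\alpha'$ of the cube (one entry changed from 0 to 1) of the maps applying $m$ (circles merge) or $\Delta$ (a circle splits), and the identity on other tensor factors, where $m(1,1)=1$, $m(1,x)=m(x,1)=x$, $m(x,x)=ux$, $\Delta(1)=1\otimes x+x\otimes1+u\,1\otimes1$,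 $\Delta(x)=x\otimes x$. It has bidegree $(1,0)$; $\mathcal C^{*,j}$ denotes the subcomplex of $q$-grading $j$, and $\mathrm{BN}^{i,j}(L)=H^i(\mathcal C^{*,j})$. Multiplication by $u$ is a chain map $\mathcal C^{*,j}\to\mathcal C^{*,j-2}$, inducing $u_*\colon\mathrm{BN}^{i,j}(L)\to\mathrm{BN}^{i,j-2}(L)$, which is an isomorphism for all sufficiently negative $j$. Filtered Bar-Natan theory: $\mathrm{BN}^*(L)'$ is the homology of $\overline{\mathcal C}^{*}$ with the $\mathbb{F}_2$-linear differential which is, on the summand $V_\alpha$, the sum over all edges $\alpha\to\alpha'$ of the cube (one entry changed from 0 to 1) of the maps applying $m_1$ (circles merge) or $\Delta_1$ (a circle splits), and the identity on other tensor factors, where $m_1$ and $\Delta_1$ are $m$ and $\Delta$ with $u=1$, i.e. $m_1(1,1)=1$, $m_1(1,x)=m_1(x,1)=x$, $m_1(x,x)=x$, $\Delta_1(1)=1\otimes x+x\otimes1+1\otimes1$, $\Delta_1(x)=x\otimes x$ (singly graded by homological degree). Stable Bar-Natan theory: with $\gamma\in\{0,1\}$ the number of components of $L$ modulo 2, $$\mathrm{BN}_s^i(L)=\varinjlim\big(u_*\colon\mathrm{BN}^{i,2k+\gamma}(L)\to\mathrm{BN}^{i,2k+\gamma-2}(L)\big),$$ the direct limit being taken as $k\to-\infty$. *)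

theory Defs
  imports
    "HOL-Algebra.Module"
    "HOL-Algebra.AbelCoset"
    "HOL-Computational_Algebra.Polynomial"
    "HOL-Library.FuncSet"
    "HOL-Library.Z2"
begin

section \<open>Oriented link diagrams\<close>

text \<open>
  Diagrams are given by oriented planar diagram (PD) codes. At a crossing the four arc ends are
  listed counterclockwise, starting with the incoming end of the under-strand, so the under-strand
  runs from \<open>a\<close> to \<open>c\<close>. The over-strand runs from \<open>d\<close> to \<open>b\<close> at a positive crossing and from
  \<open>b\<close> to \<open>d\<close> at a negative one.
\<close>

datatype 'e crossing = Pos 'e 'e 'e 'e | Neg 'e 'e 'e 'e

fun ends :: "'e crossing \<Rightarrow> 'e list" where
  "ends (Pos a b c d) = [a, b, c, d]"
| "ends (Neg a b c d) = [a, b, c, d]"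

fun incoming :: "'e crossing \<Rightarrow> 'e list" where
  "incoming (Pos a b c d) = [a, d]"
| "incoming (Neg a b c d) = [a, b]"

fun outgoing :: "'e crossing \<Rightarrow> 'e list" where
  "outgoing (Pos a b c d) = [c, b]"
| "outgoing (Neg a b c d) = [c, d]"

fun positive :: "'e crossing \<Rightarrow> bool" where
  "positive (Pos a b c d) = True"
| "positive (Neg a b c d) = False"

text \<open>An arc that is an end of no crossing is a closed component without crossings.\<close>

record 'e diagram =
  arcs :: "'e set"
  crossings :: "'e crossing list"

definition ncross :: "'e diagram \<Rightarrow> nat" where
  "ncross D = length (crossings D)"

definition npos :: "'e diagram \<Rightarrow> nat" where
  "npos D = length (filter positive (crossings D))"

definition nneg :: "'e diagram \<Rightarrow> nat" where
  "nneg D = length (filter (\<lambda>c. \<not> positive c) (crossings D))"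

abbreviation arc_at :: "'e diagram \<Rightarrow> nat \<Rightarrow> nat \<Rightarrow> 'e" where
  "arc_at D r p \<equiv> ends (crossings D ! r) ! p"

definition generated_classes :: "'a set \<Rightarrow> ('a \<Rightarrow> 'a \<Rightarrow> bool) \<Rightarrow> 'a set set" where
  "generated_classes S R = S // {(x, y). x \<in> S \<and> y \<in> S \<and> equivclp R x y}"

text \<open>Every arc that meets a crossing leaves exactly one crossing and enters exactly one.\<close>

definition oriented_code :: "'e diagram \<Rightarrow> bool" where
  "oriented_code D \<longleftrightarrow>
     finite (arcs D) \<and>
     distinct (concat (map incoming (crossings D))) \<and>
     distinct (concat (map outgoing (crossings D))) \<and>
     set (concat (map incoming (crossings D))) = set (concat (map outgoing (crossings D))) \<and>
     set (concat (map incoming (crossings D))) \<subseteq> arcs D"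

text \<open>
  The half-edge \<open>(r, p)\<close> is the \<open>p\<close>-th arc end at crossing \<open>r\<close>. The same pair also names the
  corner at \<open>r\<close> between the ends \<open>p\<close> and \<open>p + 1\<close>, that is, the corner to the left of end \<open>p\<close>
  seen from \<open>r\<close>. If \<open>(s, q)\<close> is the other end of that arc, the same side of the arc is at \<open>s\<close>
  the corner to the right of end \<open>q\<close>, namely \<open>(s, q - 1)\<close>. Faces are the classes of corners
  under this adjacency.
\<close>

definition half_edges :: "'e diagram \<Rightarrow> (nat \<times> nat) set" where
  "half_edges D = {..<ncross D} \<times> {..<4}"

definition same_side :: "'e diagram \<Rightarrow> nat \<times> nat \<Rightarrow> nat \<times> nat \<Rightarrow> bool" where
  "same_side D h k \<longleftrightarrow>
     (\<exists>r p s q. (r, p) \<in> half_edges D \<and> (s, q) \<in> half_edges D \<and> (r, p) \<noteq> (s, q) \<and>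
        arc_at D r p = arc_at D s q \<and> h = (r, p) \<and> k = (s, (q + 3) mod 4))"

definition faces :: "'e diagram \<Rightarrow> (nat \<times> nat) set set" where
  "faces D = generated_classes (half_edges D) (same_side D)"

definition edges :: "'e diagram \<Rightarrow> 'e set" where
  "edges D = (\<Union>c\<in>set (crossings D). set (ends c))"

definition pieces :: "'e diagram \<Rightarrow> nat set set" where
  "pieces D = generated_classes {..<ncross D}
     (\<lambda>r s. r < ncross D \<and> s < ncross D \<and>
        set (ends (crossings D ! r)) \<inter> set (ends (crossings D ! s)) \<noteq> {})"

text \<open>
  The underlying 4-valent graph is drawn on a sphere: Euler's formula, where faces are counted
  separately for each connected piece, so that every piece contributes 2. Without this condition
  the code would describe a virtual link diagram.
\<close>

definition planar :: "'e diagram \<Rightarrow> bool" where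
  "planar D \<longleftrightarrow>
     int (ncross D) - int (card (edges D)) + int (card (faces D)) = 2 * int (card (pieces D))"

definition link_diagram :: "'e diagram \<Rightarrow> bool" where
  "link_diagram D \<longleftrightarrow> oriented_code D \<and> planar D"

definition strand_step :: "'e diagram \<Rightarrow> 'e \<Rightarrow> 'e \<Rightarrow> bool" where
  "strand_step D e f \<longleftrightarrow>
     (\<exists>r<ncross D. e = arc_at D r 0 \<and> f = arc_at D r 2 \<or> e = arc_at D r 1 \<and> f = arc_at D r 3)"

definition components :: "'e diagram \<Rightarrow> 'e set set" where
  "components D = generated_classes (arcs D) (strand_step D)"


section \<open>The cube of smoothings\<close>

text \<open>
  A vertex \<open>\<alpha> \<in> {0,1}\<^sup>n\<close> is the set of those \<open>r < n\<close> with \<open>\<alpha>\<^sub>r = 1\<close>. The 0-smoothing joins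
  \<open>a\<close> to \<open>b\<close> and \<open>c\<close> to \<open>d\<close>, the 1-smoothing joins \<open>a\<close> to \<open>d\<close> and \<open>b\<close> to \<open>c\<close>; thus the
  oriented smoothing is the 0-smoothing at a positive and the 1-smoothing at a negative crossing.
  A circle of a smoothing is the set of arcs it runs through.
\<close>

definition smooth_step :: "'e diagram \<Rightarrow> nat set \<Rightarrow> 'e \<Rightarrow> 'e \<Rightarrow> bool" where
  "smooth_step D \<alpha> e f \<longleftrightarrow>
     (\<exists>r<ncross D.
        if r \<in> \<alpha>
        then e = arc_at D r 0 \<and> f = arc_at D r 3 \<or> e = arc_at D r 1 \<and> f = arc_at D r 2
        else e = arc_at D r 0 \<and> f = arc_at D r 1 \<or> e = arc_at D r 2 \<and> f = arc_at D r 3)"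

definition circles :: "'e diagram \<Rightarrow> nat set \<Rightarrow> 'e set set" where
  "circles D \<alpha> = generated_classes (arcs D) (smooth_step D \<alpha>)"

definition circle_of :: "'e diagram \<Rightarrow> nat set \<Rightarrow> 'e \<Rightarrow> 'e set" where
  "circle_of D \<alpha> e = {f \<in> arcs D. equivclp (smooth_step D \<alpha>) e f}"

text \<open>The basis \<open>1\<close>, \<open>x\<close> of the algebra \<open>A\<close>.\<close>

datatype gen = Gen1 | GenX

fun gdeg :: "gen \<Rightarrow> int" where
  "gdeg Gen1 = 1"
| "gdeg GenX = - 1"

text \<open>
  \<open>m_coeff u a b c\<close> is the coefficient of \<open>c\<close> in \<open>m(a,b)\<close>, and \<open>Delta_coeff u a b c\<close> the coefficient of
  \<open>b \<otimes> c\<close> in \<open>\<Delta>(a)\<close>. They are used only over rings of characteristic 2.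
\<close>

fun m_coeff :: "'r::comm_ring_1 \<Rightarrow> gen \<Rightarrow> gen \<Rightarrow> gen \<Rightarrow> 'r" where
  "m_coeff u Gen1 Gen1 c = (if c = Gen1 then 1 else 0)"
| "m_coeff u Gen1 GenX c = (if c = GenX then 1 else 0)"
| "m_coeff u GenX Gen1 c = (if c = GenX then 1 else 0)"
| "m_coeff u GenX GenX c = (if c = GenX then u else 0)"

fun Delta_coeff :: "'r::comm_ring_1 \<Rightarrow> gen \<Rightarrow> gen \<Rightarrow> gen \<Rightarrow> 'r" where
  "Delta_coeff u Gen1 Gen1 Gen1 = u"
| "Delta_coeff u Gen1 Gen1 GenX = 1"
| "Delta_coeff u Gen1 GenX Gen1 = 1"
| "Delta_coeff u Gen1 GenX GenX = 0"
| "Delta_coeff u GenX b c = (if b = GenX \<and> c = GenX then 1 else 0)"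

text \<open>
  The pure tensors of \<open>1\<close> and \<open>x\<close>, with one factor for each circle of \<open>D\<^sub>\<alpha>\<close>, for all \<open>\<alpha>\<close>: they form
  a basis of the sum of all \<open>V\<^sub>\<alpha>\<close>. Chains are functions from basis elements to coefficients.
\<close>

type_synonym 'e state = "nat set \<times> ('e set \<Rightarrow> gen)"

definition states :: "'e diagram \<Rightarrow> 'e state set" where
  "states D = (SIGMA \<alpha>:Pow {..<ncross D}. circles D \<alpha> \<rightarrow>\<^sub>E UNIV)"

definition hdeg :: "'e diagram \<Rightarrow> 'e state \<Rightarrow> int" where
  "hdeg D s = int (card (fst s)) - int (nneg D)"

definition qdeg :: "'e diagram \<Rightarrow> 'e state \<Rightarrow> int" where
  "qdeg D s = (\<Sum>C\<in>circles D (fst s). gdeg (snd s C)) + hdeg D s + int (npos D) - int (nneg D)"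

text \<open>
  Coefficient of the tensor \<open>w\<close> in the image of the tensor \<open>v\<close> under the edge map from \<open>\<alpha>\<close> to
  \<open>\<alpha> \<union> {r}\<close>. The circles through \<open>r\<close> are those containing \<open>a\<close> or \<open>c\<close>, both before
  (\<open>P\<close>, \<open>P'\<close>) and after (\<open>Q\<close>, \<open>Q'\<close>) the change. In a planar diagram either \<open>P \<noteq> P'\<close> and
  \<open>Q = Q'\<close> (merge), or \<open>P = P'\<close> and \<open>Q \<noteq> Q'\<close> (split).
\<close>

definition edge_coeff ::
  "'r::comm_ring_1 \<Rightarrow> 'e diagram \<Rightarrow> nat set \<Rightarrow> nat \<Rightarrow> ('e set \<Rightarrow> gen) \<Rightarrow> ('e set \<Rightarrow> gen) \<Rightarrow> 'r"
where
  "edge_coeff u D \<alpha> r v w =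
     (let \<beta> = insert r \<alpha>;
          P = circle_of D \<alpha> (arc_at D r 0); P' = circle_of D \<alpha> (arc_at D r 2);
          Q = circle_of D \<beta> (arc_at D r 0); Q' = circle_of D \<beta> (arc_at D r 2)
      in if \<forall>C \<in> circles D \<alpha> - {P, P'}. v C = w C
         then if P \<noteq> P' then m_coeff u (v P) (v P') (w Q)
              else if Q \<noteq> Q' then Delta_coeff u (v P) (w Q) (w Q')
              else 0
         else 0)"

definition diff_coeff :: "'r::comm_ring_1 \<Rightarrow> 'e diagram \<Rightarrow> 'e state \<Rightarrow> 'e state \<Rightarrow> 'r" where
  "diff_coeff u D s t =
     (\<Sum>r | r < ncross D \<and> r \<notin> fst s \<and> fst t = insert r (fst s).
        edge_coeff u D (fst s) r (snd s) (snd t))"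

definition diff :: "'r::comm_ring_1 \<Rightarrow> 'e diagram \<Rightarrow> ('e state \<Rightarrow> 'r) \<Rightarrow> 'e state \<Rightarrow> 'r" where
  "diff u D f = (\<lambda>t. if t \<in> states D then \<Sum>s\<in>states D. f s * diff_coeff u D s t else 0)"


section \<open>Linear algebra\<close>

text \<open>
  Vector spaces are module records. These extend ring records, whose multiplicative part is
  irrelevant and left undefined.
\<close>

definition fun_space ::
  "('k \<Rightarrow> 'r \<Rightarrow> 'r) \<Rightarrow> ('s \<Rightarrow> 'r::comm_ring_1) set \<Rightarrow> ('k, 's \<Rightarrow> 'r) module" where
  "fun_space scale S =
     \<lparr>carrier = S, monoid.mult = undefined, one = undefined,
      zero = (\<lambda>_. 0), add = (\<lambda>f g s. f s + g s), module.smult = (\<lambda>c f s. scale c (f s))\<rparr>"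

text \<open>The map into the quotient of \<open>N\<close> by \<open>B\<close> induced by \<open>\<phi>\<close>, on a coset \<open>S\<close>.\<close>

definition induced_map ::
  "('k, 'b) module \<Rightarrow> 'b set \<Rightarrow> ('a \<Rightarrow> 'b) \<Rightarrow> 'a set \<Rightarrow> 'b set" where
  "induced_map N B \<phi> S = (\<Union>z\<in>S. B +>\<^bsub>N\<^esub> \<phi> z)"

definition quotient_space :: "('k, 'a) module \<Rightarrow> 'a set \<Rightarrow> ('k, 'a set) module" where
  "quotient_space M B =
     \<lparr>carrier = a_rcosets\<^bsub>M\<^esub> B, monoid.mult = undefined, one = undefined,
      zero = B, add = set_add M, module.smult = (\<lambda>c. induced_map M B (\<lambda>z. c \<odot>\<^bsub>M\<^esub> z))\<rparr>"

definition homology ::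
  "('k, 'a) module \<Rightarrow> ('k, 'a) module \<Rightarrow> ('a \<Rightarrow> 'a) \<Rightarrow> ('k, 'a set) module" where
  "homology C' C \<delta> =
     quotient_space (C\<lparr>carrier := {z \<in> carrier C. \<delta> z = \<zero>\<^bsub>C\<^esub>}\<rparr>) (\<delta> ` carrier C')"

text \<open>
  The direct limit for \<open>k \<rightarrow> -\<infinity>\<close> of a system of maps \<open>\<phi> k\<close> from \<open>M k\<close> to \<open>M (k - 1)\<close>.
  \<open>transition \<phi> k p\<close> is the composite map from \<open>M k\<close> to \<open>M (k - p)\<close>. Elements of the limit are
  classes of pairs \<open>(k, x)\<close> with \<open>x \<in> M k\<close>, two pairs being identified if they become equal
  at some later stage.
\<close>

primrec transition :: "(int \<Rightarrow> 'a \<Rightarrow> 'a) \<Rightarrow> int \<Rightarrow> nat \<Rightarrow> 'a \<Rightarrow> 'a" where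
  "transition \<phi> k 0 x = x"
| "transition \<phi> k (Suc p) x = \<phi> (k - int p) (transition \<phi> k p x)"

definition limit_class ::
  "(int \<Rightarrow> ('k, 'a) module) \<Rightarrow> (int \<Rightarrow> 'a \<Rightarrow> 'a) \<Rightarrow> int \<times> 'a \<Rightarrow> (int \<times> 'a) set" where
  "limit_class M \<phi> a =
     {(l, y). y \<in> carrier (M l) \<and>
        (\<exists>p q. fst a - int p = l - int q \<and> transition \<phi> (fst a) p (snd a) = transition \<phi> l q y)}"

definition direct_limit ::
  "(int \<Rightarrow> ('k, 'a) module) \<Rightarrow> (int \<Rightarrow> 'a \<Rightarrow> 'a) \<Rightarrow> ('k, (int \<times> 'a) set) module" where
  "direct_limit M \<phi> =
     \<lparr>carrier = {limit_class M \<phi> (k, x) | k x. x \<in> carrier (M k)},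
      monoid.mult = undefined, one = undefined,
      zero = limit_class M \<phi> (0, \<zero>\<^bsub>M 0\<^esub>),
      add = (\<lambda>S T. \<Union>{limit_class M \<phi> (k, x \<oplus>\<^bsub>M k\<^esub> y) | k x y. (k, x) \<in> S \<and> (k, y) \<in> T}),
      module.smult = (\<lambda>c S. \<Union>{limit_class M \<phi> (k, c \<odot>\<^bsub>M k\<^esub> x) | k x. (k, x) \<in> S})\<rparr>"

definition linear_iso :: "('k, 'a) module \<Rightarrow> ('k, 'b) module \<Rightarrow> ('a \<Rightarrow> 'b) \<Rightarrow> bool" where
  "linear_iso M N f \<longleftrightarrow>
     bij_betw f (carrier M) (carrier N) \<and>
     (\<forall>x\<in>carrier M. \<forall>y\<in>carrier M. f (x \<oplus>\<^bsub>M\<^esub> y) = f x \<oplus>\<^bsub>N\<^esub> f y) \<and>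
     (\<forall>c. \<forall>x\<in>carrier M. f (c \<odot>\<^bsub>M\<^esub> x) = c \<odot>\<^bsub>N\<^esub> f x)"

definition isomorphic_spaces :: "('k, 'a) module \<Rightarrow> ('k, 'b) module \<Rightarrow> bool" where
  "isomorphic_spaces M N \<longleftrightarrow> (\<exists>f. linear_iso M N f)"


section \<open>Bar-Natan homology\<close>

text \<open>The variable \<open>u\<close> of \<open>\<bbbF>\<^sub>2[u]\<close>, of bidegree \<open>(0, -2)\<close>.\<close>

abbreviation uvar :: "bit poly" where
  "uvar \<equiv> [:0, 1:]"

definition graded_chains :: "'e diagram \<Rightarrow> int \<Rightarrow> int \<Rightarrow> (bit, 'e state \<Rightarrow> bit poly) module" where
  "graded_chains D i j = fun_space Polynomial.smult
     {f. \<forall>s n. coeff (f s) n \<noteq> 0 \<longrightarrow>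
           s \<in> states D \<and> hdeg D s = i \<and> qdeg D s - 2 * int n = j}"

definition BN :: "'e diagram \<Rightarrow> int \<Rightarrow> int \<Rightarrow> (bit, ('e state \<Rightarrow> bit poly) set) module" where
  "BN D i j = homology (graded_chains D (i - 1) j) (graded_chains D i j) (diff uvar D)"

definition u_star ::
  "'e diagram \<Rightarrow> int \<Rightarrow> int \<Rightarrow> ('e state \<Rightarrow> bit poly) set \<Rightarrow> ('e state \<Rightarrow> bit poly) set" where
  "u_star D i j =
     induced_map (graded_chains D i (j - 2))
       (diff uvar D ` carrier (graded_chains D (i - 1) (j - 2)))
       (\<lambda>f s. uvar * f s)"

definition BN_stable :: "'e diagram \<Rightarrow> int \<Rightarrow> (bit, (int \<times> ('e state \<Rightarrow> bit poly) set) set) module"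
where
  "BN_stable D i =
     (let \<gamma> = int (card (components D) mod 2)
      in direct_limit (\<lambda>k. BN D i (2 * k + \<gamma>)) (\<lambda>k. u_star D i (2 * k + \<gamma>)))"

definition filtered_chains :: "'e diagram \<Rightarrow> int \<Rightarrow> (bit, 'e state \<Rightarrow> bit) module" where
  "filtered_chains D i = fun_space (*) {f. \<forall>s. f s \<noteq> 0 \<longrightarrow> s \<in> states D \<and> hdeg D s = i}"

definition BN_filtered :: "'e diagram \<Rightarrow> int \<Rightarrow> (bit, ('e state \<Rightarrow> bit) set) module" where
  "BN_filtered D i = homology (filtered_chains D (i - 1)) (filtered_chains D i) (diff 1 D)"

end

theory Submission
  imports Defs "HOL-Combinatorics.Permutations" "HOL-Library.Function_Algebras"
begin

text \<open>
  Substituting \<open>u = 1\<close> turns a graded chain into a filtered one. In \<open>q\<close>-grading \<open>j\<close> the coefficient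
  of a state \<open>s\<close> is a scalar times the power \<open>u\<^sup>n\<close> with \<open>2n = q(s) - j\<close>, so the substitution is
  injective there, and its image consists of the filtered chains supported on states with
  \<open>q(s) \<ge> j\<close> and \<open>q(s) - j\<close> even. It commutes with the differentials and does not see a factor
  \<open>u\<close>. There are finitely many states; hence, if all their \<open>q\<close>-gradings have the parity \<open>\<gamma>\<close>, then
  for every sufficiently negative \<open>j\<close> of this parity the substitution is an isomorphism of chain
  spaces in all homological degrees, and therefore of homology. A direct limit whose stages have
  compatible maps to a fixed space that are eventually isomorphisms is isomorphic to this space
  (\<open>direct_limit_isomorphic\<close>), which gives \<open>stable_filtered_isomorphic\<close>.

  Two geometric facts are left: the graded differential preserves the \<open>q\<close>-grading
  (\<open>homogeneous\<close>), and all \<open>q\<close>-gradings have the parity of the number of components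
  (\<open>qdeg_parity\<close>). Both follow once it is known that changing the smoothing at one crossing either
  merges two circles into one or splits one circle into two (\<open>smoothing_change\<close>). A virtual diagram
  may violate this, so the planarity of the diagram has to enter. It does so through a
  checkerboard colouring of the faces. Orient every arc such that the black face is on its left.
  Around a crossing the ends are then alternately incoming and outgoing, so both smoothings
  respect the orientation. The circles of any smoothing are thus the cycles of a permutation of
  the arcs, and changing the smoothing at one crossing composes this permutation with a
  transposition, which merges two cycles or splits one (\<open>joins_transpose\<close>). The same
  permutation argument, now for the orientation of the link, compares the number of components
  with the number of circles of the oriented smoothing.

  The colouring comes from Euler's formula (\<open>planar_checkerboard\<close>). Counting elements in the
  cellular chain complex over \<open>\<bbbF>\<^sub>2\<close> of the cell decomposition given by the diagram, the formula shows
  that every 1-cycle is a boundary. The sum of all arcs is a 1-cycle, because four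
  ends meet at each crossing, and the 2-chain that it bounds is the set of black faces.
\<close>

section \<open>Direct limits that become stationary\<close>

lemma transition_closed:
  assumes "\<And>k x. x \<in> carrier (M k) \<Longrightarrow> \<phi> k x \<in> carrier (M (k - 1))"
    and "x \<in> carrier (M k)"
  shows "transition \<phi> k p x \<in> carrier (M (k - int p))"
proof (induction p)
  case (Suc p)
  show ?case using assms(1)[OF Suc] by (simp add: algebra_simps)
qed (use assms in simp)

lemma transition_compatible:
  assumes "\<And>k x. x \<in> carrier (M k) \<Longrightarrow> \<phi> k x \<in> carrier (M (k - 1))"
    and "\<And>k x. x \<in> carrier (M k) \<Longrightarrow> \<psi> (k - 1) (\<phi> k x) = \<psi> k x"
    and "x \<in> carrier (M k)"
  shows "\<psi> (k - int p) (transition \<phi> k p x) = \<psi> k x"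
proof (induction p)
  case (Suc p)
  have "transition \<phi> k p x \<in> carrier (M (k - int p))"
    by (rule transition_closed) (use assms in auto)
  from assms(2)[OF this] Suc show ?case by (simp add: algebra_simps)
qed simp

text \<open>
  Two pairs that have the same image in \<open>N\<close> can both be moved to a stage below \<open>K\<close>, where \<open>\<psi>\<close> is
  injective, and so they are identified in the limit. The elements of the limit are therefore
  the fibres of \<open>\<psi>\<close> over \<open>N\<close>, and these are nonempty because \<open>\<psi>\<close> is surjective at stage \<open>K\<close>.
\<close>

lemma direct_limit_isomorphic:
  fixes M :: "int \<Rightarrow> ('k, 'a) module" and N :: "('k, 'b) module"
  assumes add_closed: "\<And>k x y. x \<in> carrier (M k) \<Longrightarrow> y \<in> carrier (M k) \<Longrightarrow> x \<oplus>\<^bsub>M k\<^esub> y \<in> carrier (M k)"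
    and smult_closed: "\<And>k c x. x \<in> carrier (M k) \<Longrightarrow> c \<odot>\<^bsub>M k\<^esub> x \<in> carrier (M k)"
    and phi: "\<And>k x. x \<in> carrier (M k) \<Longrightarrow> \<phi> k x \<in> carrier (M (k - 1))"
    and psi: "\<And>k x. x \<in> carrier (M k) \<Longrightarrow> \<psi> k x \<in> carrier N"
    and psi_add: "\<And>k x y. x \<in> carrier (M k) \<Longrightarrow> y \<in> carrier (M k) \<Longrightarrow>
        \<psi> k (x \<oplus>\<^bsub>M k\<^esub> y) = \<psi> k x \<oplus>\<^bsub>N\<^esub> \<psi> k y"
    and psi_smult: "\<And>k c x. x \<in> carrier (M k) \<Longrightarrow> \<psi> k (c \<odot>\<^bsub>M k\<^esub> x) = c \<odot>\<^bsub>N\<^esub> \<psi> k x"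
    and compatible: "\<And>k x. x \<in> carrier (M k) \<Longrightarrow> \<psi> (k - 1) (\<phi> k x) = \<psi> k x"
    and bij: "\<And>k. k \<le> K \<Longrightarrow> bij_betw (\<psi> k) (carrier (M k)) (carrier N)"
  shows "isomorphic_spaces (direct_limit M \<phi>) N"
proof -
  \<comment> \<open>the fibre over \<open>n\<close>; the inverse of \<open>L\<close> is the isomorphism\<close>
  define L where "L n = {(l, y). y \<in> carrier (M l) \<and> \<psi> l y = n}" for n
  have trans_in: "transition \<phi> k p x \<in> carrier (M (k - int p))" if "x \<in> carrier (M k)" for k p x
    using that by (intro transition_closed phi)
  have trans_psi: "\<psi> (k - int p) (transition \<phi> k p x) = \<psi> k x" if "x \<in> carrier (M k)" for k p x
    using that by (intro transition_compatible[where M = M] phi compatible)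
  have class_eq: "limit_class M \<phi> (k, x) = L (\<psi> k x)" if x: "x \<in> carrier (M k)" for k x
  proof -
    have "(l, y) \<in> limit_class M \<phi> (k, x) \<longleftrightarrow> (l, y) \<in> L (\<psi> k x)" for l y
    proof
      assume "(l, y) \<in> limit_class M \<phi> (k, x)"
      then obtain p q where y: "y \<in> carrier (M l)" and pq: "k - int p = l - int q"
        and eq: "transition \<phi> k p x = transition \<phi> l q y"
        by (auto simp: limit_class_def)
      have "\<psi> k x = \<psi> l y"
        using trans_psi[OF x, of p] trans_psi[OF y, of q] pq eq by simp
      with y show "(l, y) \<in> L (\<psi> k x)" by (simp add: L_def)
    next
      assume "(l, y) \<in> L (\<psi> k x)"
      then have y: "y \<in> carrier (M l)" and eq: "\<psi> l y = \<psi> k x" by (auto simp: L_def)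
      define m where "m = min K (min k l)"
      define p q where "p = nat (k - m)" and "q = nat (l - m)"
      have pm: "k - int p = m" and qm: "l - int q = m" by (auto simp: p_def q_def m_def)
      have "inj_on (\<psi> m) (carrier (M m))" using bij[of m] by (simp add: m_def bij_betw_def)
      then have "transition \<phi> k p x = transition \<phi> l q y"
        using trans_psi[OF x, of p] trans_psi[OF y, of q] trans_in[OF x, of p] trans_in[OF y, of q] eq
        unfolding pm qm by (simp add: inj_on_def)
      moreover have "k - int p = l - int q" using pm qm by simp
      ultimately show "(l, y) \<in> limit_class M \<phi> (k, x)"
        using y by (simp add: limit_class_def) blast
    qed
    then show ?thesis by auto
  qed
  have surj: "\<exists>x\<in>carrier (M K). \<psi> K x = n" if "n \<in> carrier N" for n
    using bij[of K] that unfolding bij_betw_def by (metis image_iff order_refl)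
  have carrier_eq: "carrier (direct_limit M \<phi>) = L ` carrier N"
  proof -
    have "carrier (direct_limit M \<phi>) = (\<Union>k. (\<lambda>x. limit_class M \<phi> (k, x)) ` carrier (M k))"
      unfolding direct_limit_def by auto
    also have "\<dots> = (\<Union>k. L ` \<psi> k ` carrier (M k))"
      unfolding image_image by (intro SUP_cong image_cong refl class_eq)
    also have "\<dots> = L ` carrier N"
    proof
      show "(\<Union>k. L ` \<psi> k ` carrier (M k)) \<subseteq> L ` carrier N" using psi by blast
      have "carrier N \<subseteq> \<psi> K ` carrier (M K)" using bij[of K] by (simp add: bij_betw_def)
      then show "L ` carrier N \<subseteq> (\<Union>k. L ` \<psi> k ` carrier (M k))"
        by (intro order_trans[OF image_mono UN_upper[of K]]) auto
    qed
    finally show ?thesis .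
  qed
  have inj: "inj_on L (carrier N)"
  proof (rule inj_onI)
    fix n n' assume n: "n \<in> carrier N" and eq: "L n = L n'"
    obtain x where "x \<in> carrier (M K)" "\<psi> K x = n" using surj[OF n] by blast
    then have "(K, x) \<in> L n'" unfolding eq[symmetric] by (simp add: L_def)
    with \<open>\<psi> K x = n\<close> show "n = n'" by (simp add: L_def)
  qed
  have L_add: "L n \<oplus>\<^bsub>direct_limit M \<phi>\<^esub> L n' = L (n \<oplus>\<^bsub>N\<^esub> n')"
    if n: "n \<in> carrier N" and n': "n' \<in> carrier N" for n n'
  proof -
    have "{limit_class M \<phi> (k, x \<oplus>\<^bsub>M k\<^esub> y) | k x y. (k, x) \<in> L n \<and> (k, y) \<in> L n'} = {L (n \<oplus>\<^bsub>N\<^esub> n')}"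
      (is "?lhs = ?rhs")
    proof
      show "?lhs \<subseteq> ?rhs" by (auto simp: L_def[of n] L_def[of n'] class_eq add_closed psi_add)
      obtain x y where "x \<in> carrier (M K)" "\<psi> K x = n" "y \<in> carrier (M K)" "\<psi> K y = n'"
        using surj n n' by metis
      then have "(K, x) \<in> L n" "(K, y) \<in> L n'"
        "limit_class M \<phi> (K, x \<oplus>\<^bsub>M K\<^esub> y) = L (n \<oplus>\<^bsub>N\<^esub> n')"
        by (auto simp: L_def[of n] L_def[of n'] class_eq add_closed psi_add)
      then show "?rhs \<subseteq> ?lhs" by blast
    qed
    then show ?thesis by (simp add: direct_limit_def)
  qed
  have L_smult: "c \<odot>\<^bsub>direct_limit M \<phi>\<^esub> L n = L (c \<odot>\<^bsub>N\<^esub> n)" if n: "n \<in> carrier N" for c n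
  proof -
    have "{limit_class M \<phi> (k, c \<odot>\<^bsub>M k\<^esub> x) | k x. (k, x) \<in> L n} = {L (c \<odot>\<^bsub>N\<^esub> n)}" (is "?lhs = ?rhs")
    proof
      show "?lhs \<subseteq> ?rhs" by (auto simp: L_def[of n] class_eq smult_closed psi_smult)
      obtain x where "x \<in> carrier (M K)" "\<psi> K x = n"
        using surj n by metis
      then have "(K, x) \<in> L n" "limit_class M \<phi> (K, c \<odot>\<^bsub>M K\<^esub> x) = L (c \<odot>\<^bsub>N\<^esub> n)"
        by (auto simp: L_def[of n] class_eq smult_closed psi_smult)
      then show "?rhs \<subseteq> ?lhs" by blast
    qed
    then show ?thesis by (simp add: direct_limit_def)
  qed
  have N_add: "n \<oplus>\<^bsub>N\<^esub> n' \<in> carrier N" if n: "n \<in> carrier N" and n': "n' \<in> carrier N" for n n'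
    using surj[OF n] surj[OF n'] psi_add add_closed psi by metis
  have N_smult: "c \<odot>\<^bsub>N\<^esub> n \<in> carrier N" if n: "n \<in> carrier N" for c n
    using surj[OF n] psi_smult smult_closed psi by metis
  define f where "f = the_inv_into (carrier N) L"
  have f: "f (L n) = n" if "n \<in> carrier N" for n
    using that inj by (simp add: f_def the_inv_into_f_f)
  have "linear_iso (direct_limit M \<phi>) N f"
    unfolding linear_iso_def carrier_eq
  proof (intro conjI ballI allI)
    show "bij_betw f (L ` carrier N) (carrier N)"
      unfolding f_def using inj by (intro bij_betw_the_inv_into) (simp add: bij_betw_def)
  qed (auto simp: f L_add L_smult N_add N_smult)
  then show ?thesis by (auto simp: isomorphic_spaces_def)
qed

section \<open>Cosets and homology of function spaces\<close>

text \<open>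
  All records made by \<open>fun_space\<close> have the same addition, and so the same cosets. Defining these for
  the type class keeps the records out of the computations.
\<close>

definition coset :: "'a::ab_group_add set \<Rightarrow> 'a \<Rightarrow> 'a set" where
  "coset B z = (\<lambda>b. b + z) ` B"

definition add_subgroup :: "'a::ab_group_add set \<Rightarrow> bool" where
  "add_subgroup B \<longleftrightarrow> 0 \<in> B \<and> (\<forall>x\<in>B. \<forall>y\<in>B. x - y \<in> B)"

lemma add_subgroup_add: "add_subgroup B \<Longrightarrow> x \<in> B \<Longrightarrow> y \<in> B \<Longrightarrow> x + y \<in> B"
  unfolding add_subgroup_def by (metis diff_0 diff_minus_eq_add)

lemma mem_coset: "y \<in> coset B z \<longleftrightarrow> y - z \<in> B"
  unfolding coset_def by (auto simp: image_iff) (metis diff_add_cancel)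

lemma coset_eq_iff:
  assumes "add_subgroup B"
  shows "coset B y = coset B z \<longleftrightarrow> y - z \<in> B"
proof
  assume "coset B y = coset B z"
  moreover have "y \<in> coset B y" using assms by (simp add: mem_coset add_subgroup_def)
  ultimately show "y - z \<in> B" by (simp add: mem_coset)
next
  assume yz: "y - z \<in> B"
  have "x - y \<in> B \<longleftrightarrow> x - z \<in> B" for x
  proof
    assume "x - y \<in> B"
    from add_subgroup_add[OF assms this yz] show "x - z \<in> B" by simp
  next
    assume "x - z \<in> B"
    with yz assms have "(x - z) - (y - z) \<in> B" unfolding add_subgroup_def by blast
    then show "x - y \<in> B" by simp
  qed
  then show "coset B y = coset B z" by (simp add: set_eq_iff mem_coset)
qed

lemma coset_self: "add_subgroup B \<Longrightarrow> z \<in> coset B z"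
  by (simp add: mem_coset add_subgroup_def)

lemma fun_space_simps [simp]:
  "carrier (fun_space sc S) = S"
  "add (fun_space sc S) = (+)"
  "zero (fun_space sc S) = 0"
  "module.smult (fun_space sc S) = (\<lambda>c f s. sc c (f s))"
  "fun_space sc S\<lparr>carrier := T\<rparr> = fun_space sc T"
  by (simp_all add: fun_space_def zero_fun_def plus_fun_def fun_eq_iff)

lemma a_r_coset_fun_space [simp]: "B +>\<^bsub>fun_space sc S\<^esub> z = coset B z"
  by (auto simp: a_r_coset_def r_coset_def coset_def)

text \<open>
  Two members of a coset of \<open>B\<close> differ by an element of \<open>B\<close>, which \<open>\<phi>\<close> maps into \<open>B'\<close>; so the
  union that defines the induced map is a union of equal cosets.
\<close>

lemma induced_map_coset:
  assumes B: "add_subgroup B" and B': "add_subgroup B'"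
    and add: "\<And>x y. \<phi> (x + y) = \<phi> x + \<phi> y" and sub: "\<phi> ` B \<subseteq> B'"
  shows "induced_map (fun_space sc S) B' \<phi> (coset B z) = coset B' (\<phi> z)"
proof -
  have "coset B' (\<phi> y) = coset B' (\<phi> z)" if "y \<in> coset B z" for y
  proof -
    have "\<phi> y = \<phi> (y - z) + \<phi> z" by (simp flip: add)
    then have "\<phi> y - \<phi> z = \<phi> (y - z)" by simp
    with that sub show ?thesis by (auto simp: coset_eq_iff[OF B'] mem_coset)
  qed
  then have "(\<Union>y\<in>coset B z. coset B' (\<phi> y)) = (\<Union>y\<in>coset B z. coset B' (\<phi> z))"
    by (intro SUP_cong refl)
  also have "\<dots> = coset B' (\<phi> z)" using coset_self[OF B, of z] by blast
  finally show ?thesis by (simp add: induced_map_def)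
qed

lemma set_add_coset:
  assumes "add_subgroup B"
  shows "set_add (fun_space sc S) (coset B y) (coset B z) = coset B (y + z)"
proof -
  have "x \<in> (\<Union>h\<in>coset B y. \<Union>k\<in>coset B z. {h + k}) \<longleftrightarrow> x \<in> coset B (y + z)" for x
  proof
    assume "x \<in> (\<Union>h\<in>coset B y. \<Union>k\<in>coset B z. {h + k})"
    then obtain h k where "x = h + k" "h - y \<in> B" "k - z \<in> B" by (auto simp: mem_coset)
    moreover have "x - (y + z) = (h - y) + (k - z)" unfolding \<open>x = h + k\<close> by (rule add_diff_add)
    ultimately show "x \<in> coset B (y + z)" unfolding mem_coset by (metis add_subgroup_add assms)
  next
    assume "x \<in> coset B (y + z)"
    then have "x - z \<in> coset B y" by (simp add: mem_coset algebra_simps)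
    then show "x \<in> (\<Union>h\<in>coset B y. \<Union>k\<in>coset B z. {h + k})"
      using coset_self[OF assms, of z] by force
  qed
  then have "(\<Union>h\<in>coset B y. \<Union>k\<in>coset B z. {h + k}) = coset B (y + z)" by blast
  then show ?thesis by (simp add: set_add_def set_mult_def)
qed

lemma homology_simps:
  fixes C :: "('s \<Rightarrow> 'r::comm_ring_1) set"
  shows "carrier (homology (fun_space sc C') (fun_space sc C) \<delta>) = coset (\<delta> ` C') ` {z \<in> C. \<delta> z = 0}"
    and "add (homology (fun_space sc C') (fun_space sc C) \<delta>) = set_add (fun_space sc {z \<in> C. \<delta> z = 0})"
    and "module.smult (homology (fun_space sc C') (fun_space sc C) \<delta>) =
      (\<lambda>c. induced_map (fun_space sc {z \<in> C. \<delta> z = 0}) (\<delta> ` C') (\<lambda>z s. sc c (z s)))"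
proof -
  have "homology (fun_space sc C') (fun_space sc C) \<delta> =
      quotient_space (fun_space sc {z \<in> C. \<delta> z = 0}) (\<delta> ` C')"
    by (simp add: homology_def)
  moreover have "a_rcosets\<^bsub>fun_space sc Z\<^esub> B = coset B ` Z" for Z B
    unfolding A_RCOSETS_defs a_r_coset_def[symmetric] by auto
  ultimately show "carrier (homology (fun_space sc C') (fun_space sc C) \<delta>) = coset (\<delta> ` C') ` {z \<in> C. \<delta> z = 0}"
    and "add (homology (fun_space sc C') (fun_space sc C) \<delta>) = set_add (fun_space sc {z \<in> C. \<delta> z = 0})"
    and "module.smult (homology (fun_space sc C') (fun_space sc C) \<delta>) =
      (\<lambda>c. induced_map (fun_space sc {z \<in> C. \<delta> z = 0}) (\<delta> ` C') (\<lambda>z s. sc c (z s)))"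
    by (simp_all add: quotient_space_def)
qed

text \<open>
  A scalar in \<open>\<bbbF>\<^sub>2\<close> acts as zero or as the identity, so it maps every subgroup into itself.
\<close>

lemma smult_coset:
  fixes sc :: "bit \<Rightarrow> 'r \<Rightarrow> 'r::comm_ring_1" and B :: "('s \<Rightarrow> 'r) set"
  assumes "add_subgroup B" and "\<And>x. sc 0 x = 0" "\<And>x. sc 1 x = x"
  shows "induced_map (fun_space sc S) B (\<lambda>z s. sc c (z s)) (coset B z) = coset B (\<lambda>s. sc c (z s))"
proof (rule induced_map_coset[OF assms(1,1)])
  show "(\<lambda>s. sc c ((x + y) s)) = (\<lambda>s. sc c (x s)) + (\<lambda>s. sc c (y s))" for x y :: "'s \<Rightarrow> 'r"
    using assms(2,3) by (cases c) (auto simp: fun_eq_iff)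
  have "(\<lambda>s. sc c (x s)) = 0 \<or> (\<lambda>s. sc c (x s)) = x" for x :: "'s \<Rightarrow> 'r"
    using assms(2,3) by (cases c) (auto simp: fun_eq_iff)
  then show "(\<lambda>z s. sc c (z s)) ` B \<subseteq> B"
    using assms(1) unfolding add_subgroup_def image_subset_iff by metis
qed

section \<open>The substitution u = 1\<close>

definition gchains :: "'e diagram \<Rightarrow> int \<Rightarrow> int \<Rightarrow> ('e state \<Rightarrow> bit poly) set" where
  "gchains D i j = {f. \<forall>s n. coeff (f s) n \<noteq> 0 \<longrightarrow>
           s \<in> states D \<and> hdeg D s = i \<and> qdeg D s - 2 * int n = j}"

definition fchains :: "'e diagram \<Rightarrow> int \<Rightarrow> ('e state \<Rightarrow> bit) set" where
  "fchains D i = {f. \<forall>s. f s \<noteq> 0 \<longrightarrow> s \<in> states D \<and> hdeg D s = i}"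

definition at_one :: "('s \<Rightarrow> bit poly) \<Rightarrow> 's \<Rightarrow> bit" where
  "at_one f = (\<lambda>s. poly (f s) 1)"

lemma graded_chains_eq: "graded_chains D i j = fun_space Polynomial.smult (gchains D i j)"
  by (simp add: graded_chains_def gchains_def)

lemma filtered_chains_eq: "filtered_chains D i = fun_space (*) (fchains D i)"
  by (simp add: filtered_chains_def fchains_def)

lemma poly_m_coeff: "poly (m_coeff uvar a b c) 1 = m_coeff 1 a b c"
  by (cases a; cases b) auto

lemma poly_Delta_coeff: "poly (Delta_coeff uvar a b c) 1 = Delta_coeff 1 a b c"
  by (cases a; cases b; cases c) auto

lemma poly_diff_coeff: "poly (diff_coeff uvar D s t) 1 = diff_coeff 1 D s t"
  by (auto simp: diff_coeff_def poly_sum edge_coeff_def Let_def poly_m_coeff poly_Delta_coeff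
      intro!: sum.cong)

lemma at_one_diff: "at_one (diff uvar D f) = diff 1 D (at_one f)"
  by (auto simp: at_one_def diff_def poly_sum poly_diff_coeff fun_eq_iff)

lemma at_one_add: "at_one (f + g) = at_one f + at_one g"
  by (auto simp: at_one_def fun_eq_iff)

lemma at_one_minus: "at_one (f - g) = at_one f - at_one g"
  by (auto simp: at_one_def fun_eq_iff)

lemma at_one_uvar: "at_one (\<lambda>s. uvar * f s) = at_one f"
  by (auto simp: at_one_def fun_eq_iff)

lemma diff_minus_chains: "diff u D (f - g) = diff u D f - diff u D g"
  by (auto simp: diff_def fun_eq_iff algebra_simps sum_subtractf)

lemma diff_zero_chain: "diff u D 0 = 0"
  by (auto simp: diff_def fun_eq_iff)

lemma diff_scale_chain: "diff u D (\<lambda>s. c * f s) = (\<lambda>s. c * diff u D f s)"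
  by (auto simp: diff_def fun_eq_iff sum_distrib_left algebra_simps)

lemma add_subgroup_diff_image: "add_subgroup C \<Longrightarrow> add_subgroup (diff u D ` C)"
  unfolding add_subgroup_def
  by (auto simp flip: diff_minus_chains) (metis diff_zero_chain image_eqI)

lemma add_subgroup_cycles: "add_subgroup C \<Longrightarrow> add_subgroup {z \<in> C. diff u D z = 0}"
  unfolding add_subgroup_def by (auto simp: diff_minus_chains diff_zero_chain)

lemma add_subgroup_gchains: "add_subgroup (gchains D i j)"
  unfolding add_subgroup_def gchains_def by auto

lemma add_subgroup_fchains: "add_subgroup (fchains D i)"
  unfolding add_subgroup_def fchains_def by auto

lemma at_one_gchains: "f \<in> gchains D i j \<Longrightarrow> at_one f \<in> fchains D i"
  unfolding gchains_def fchains_def at_one_def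
  by (clarsimp simp del: bit_not_zero_iff) (metis leading_coeff_0_iff poly_0)

lemma gchainsD:
  assumes "f \<in> gchains D i j" "coeff (f s) n \<noteq> 0"
  shows "s \<in> states D" "hdeg D s = i" "qdeg D s - 2 * int n = j"
  using assms unfolding gchains_def by blast+

lemma fchainsD:
  assumes "f \<in> fchains D i" "f s \<noteq> 0"
  shows "s \<in> states D" "hdeg D s = i"
  using assms unfolding fchains_def by blast+

lemma uvar_gchains:
  assumes f: "f \<in> gchains D i j"
  shows "(\<lambda>s. uvar * f s) \<in> gchains D i (j - 2)"
  unfolding gchains_def
proof clarify
  fix s n assume "coeff (uvar * f s) n \<noteq> 0"
  then obtain m where "n = Suc m" "coeff (f s) m \<noteq> 0"
    by (cases n) (auto simp: coeff_pCons)
  then show "s \<in> states D \<and> hdeg D s = i \<and> qdeg D s - 2 * int n = j - 2"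
    using gchainsD[OF f, of s m] by simp
qed

text \<open>
  The \<open>q\<close>-grading fixes the exponent of \<open>u\<close> in the coefficient of each state, so the coefficient
  is a single monomial and cannot vanish at \<open>u = 1\<close> without being zero.
\<close>

lemma at_one_eq_0:
  assumes f: "f \<in> gchains D i j" and 0: "at_one f = 0"
  shows "f = 0"
proof
  fix s
  define n where "n = degree (f s)"
  show "f s = 0 s"
  proof (rule ccontr)
    assume "f s \<noteq> 0 s"
    then have lc: "coeff (f s) n \<noteq> 0" by (simp add: n_def)
    have "coeff (f s) m = 0" if "m \<noteq> n" for m
    proof (rule ccontr)
      assume "coeff (f s) m \<noteq> 0"
      then have "qdeg D s - 2 * int m = j" by (rule gchainsD[OF f])
      moreover have "qdeg D s - 2 * int n = j" by (rule gchainsD[OF f lc])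
      ultimately show False using that by simp
    qed
    then have "f s = monom (coeff (f s) n) n" by (intro poly_eqI) auto
    then have "poly (f s) 1 = coeff (f s) n" by (metis mult.right_neutral poly_monom power_one)
    moreover have "poly (f s) 1 = 0" using fun_cong[OF 0, of s] by (simp add: at_one_def)
    ultimately show False using lc by simp
  qed
qed

text \<open>
  A state \<open>s\<close> reaches the \<open>q\<close>-grading \<open>j\<close> after multiplication by \<open>u\<close> to the power
  \<open>(q(s) - j) / 2\<close>; the condition on \<open>j\<close> makes this a natural number for every \<open>s\<close>.
\<close>

lemma at_one_surj:
  assumes g: "g \<in> fchains D i" and j: "\<And>s. s \<in> states D \<Longrightarrow> j \<le> qdeg D s \<and> even (qdeg D s - j)"
  shows "\<exists>f\<in>gchains D i j. at_one f = g"
proof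
  define f where "f s = monom (g s) (nat ((qdeg D s - j) div 2))" for s
  have "poly (f s) 1 = g s" for s by (cases "g s") (simp_all add: f_def poly_monom)
  then show "at_one f = g" by (simp add: at_one_def)
  show "f \<in> gchains D i j" unfolding gchains_def
  proof clarify
    fix s n assume "coeff (f s) n \<noteq> 0"
    then have n: "n = nat ((qdeg D s - j) div 2)" and gs: "g s \<noteq> 0"
      by (auto simp: f_def split: if_splits)
    have s: "s \<in> states D" "hdeg D s = i" using fchainsD[OF g gs] by auto
    with j[OF s(1)] n show "s \<in> states D \<and> hdeg D s = i \<and> qdeg D s - 2 * int n = j" by auto
  qed
qed

text \<open>
  Bidegree \<open>(1, 0)\<close> of the graded differential, in terms of basis elements: a factor \<open>u\<^sup>n\<close> lowers the
  \<open>q\<close>-grading by \<open>2n\<close>, and the target state makes up for it.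
\<close>

definition diff_homogeneous :: "'e diagram \<Rightarrow> bool" where
  "diff_homogeneous D \<longleftrightarrow> (\<forall>s\<in>states D. \<forall>t\<in>states D. \<forall>n. coeff (diff_coeff uvar D s t) n \<noteq> 0 \<longrightarrow>
     hdeg D t = hdeg D s + 1 \<and> qdeg D t = qdeg D s + 2 * int n)"

lemma diff_gchains:
  assumes D: "diff_homogeneous D" and f: "f \<in> gchains D i j"
  shows "diff uvar D f \<in> gchains D (i + 1) j"
  unfolding gchains_def
proof clarify
  fix t n assume nz: "coeff (diff uvar D f t) n \<noteq> 0"
  then have t: "t \<in> states D" by (auto simp: diff_def split: if_splits)
  with nz have "(\<Sum>s\<in>states D. coeff (f s * diff_coeff uvar D s t) n) \<noteq> 0"
    by (simp add: diff_def coeff_sum)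
  then obtain s where s: "s \<in> states D" "coeff (f s * diff_coeff uvar D s t) n \<noteq> 0"
    by (metis (no_types, lifting) sum.neutral)
  then obtain k where k: "k \<le> n" "coeff (f s) k * coeff (diff_coeff uvar D s t) (n - k) \<noteq> 0"
    unfolding coeff_mult by (metis (no_types, lifting) atMost_iff sum.neutral)
  then have "hdeg D s = i" "qdeg D s - 2 * int k = j"
    using gchainsD[OF f, of s k] by auto
  moreover have "hdeg D t = hdeg D s + 1 \<and> qdeg D t = qdeg D s + 2 * int (n - k)"
  proof -
    have "coeff (diff_coeff uvar D s t) (n - k) \<noteq> 0" using k(2) by auto
    then show ?thesis using D s t unfolding diff_homogeneous_def by blast
  qed
  ultimately show "t \<in> states D \<and> hdeg D t = i + 1 \<and> qdeg D t - 2 * int n = j"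
    using t k(1) by (auto simp: of_nat_diff)
qed

text \<open>
  For \<open>j\<close> below all \<open>q\<close>-gradings of states, and of their parity, setting \<open>u = 1\<close> identifies the graded
  chains with all filtered chains, in degree \<open>i\<close> as well as in degree \<open>i - 1\<close>. Injectivity
  on homology uses that a chain which bounds after the substitution already bounds
  before: the difference to the lifted boundary is homogeneous and vanishes at \<open>u = 1\<close>.
\<close>

theorem stable_filtered_isomorphic:
  assumes hom: "diff_homogeneous D" and fin: "finite (states D)"
    and parity: "\<And>s. s \<in> states D \<Longrightarrow> even (qdeg D s - int (card (components D) mod 2))"
  shows "isomorphic_spaces (BN_stable D i) (BN_filtered D i)"
proof -
  define \<gamma> where "\<gamma> = int (card (components D) mod 2)"
  define Z where "Z j = {z \<in> gchains D i j. diff uvar D z = 0}" for j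
  define B where "B j = diff uvar D ` gchains D (i - 1) j" for j
  define Z' where "Z' = {z \<in> fchains D i. diff 1 D z = 0}"
  define B' where "B' = diff 1 D ` fchains D (i - 1)"
  have B: "add_subgroup (B j)" for j
    unfolding B_def by (intro add_subgroup_diff_image add_subgroup_gchains)
  have B': "add_subgroup B'"
    unfolding B'_def by (intro add_subgroup_diff_image add_subgroup_fchains)
  have Z: "add_subgroup (Z j)" for j
    unfolding Z_def by (intro add_subgroup_cycles add_subgroup_gchains)
  have carrier_BN: "carrier (BN D i j) = coset (B j) ` Z j"
    and add_BN: "coset (B j) y \<oplus>\<^bsub>BN D i j\<^esub> coset (B j) z = coset (B j) (y + z)"
    and smult_BN: "c \<odot>\<^bsub>BN D i j\<^esub> coset (B j) z = coset (B j) (\<lambda>s. smult c (z s))" for j y z c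
    unfolding BN_def graded_chains_eq homology_simps B_def[symmetric] Z_def[symmetric]
    by (rule refl, rule set_add_coset[OF B], rule smult_coset[OF B]) simp_all
  have carrier_F: "carrier (BN_filtered D i) = coset B' ` Z'"
    and add_F: "coset B' y' \<oplus>\<^bsub>BN_filtered D i\<^esub> coset B' z' = coset B' (y' + z')"
    and smult_F: "c \<odot>\<^bsub>BN_filtered D i\<^esub> coset B' z' = coset B' (\<lambda>s. c * (z' s))" for y' z' c
    unfolding BN_filtered_def filtered_chains_eq homology_simps B'_def[symmetric] Z'_def[symmetric]
    by (rule refl, rule set_add_coset[OF B'], rule smult_coset[OF B']) simp_all
  have u_star: "u_star D i j (coset (B j) z) = coset (B (j - 2)) (\<lambda>s. uvar * z s)" for j z
    unfolding u_star_def graded_chains_eq fun_space_simps B_def[symmetric]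
  proof (rule induced_map_coset[OF B B])
    show "(\<lambda>f s. uvar * f s) ` B j \<subseteq> B (j - 2)"
      unfolding B_def by (auto simp del: mult_pCons_left simp flip: diff_scale_chain intro!: imageI uvar_gchains)
  qed (auto simp: fun_eq_iff)
  have uZ: "(\<lambda>s. uvar * z s) \<in> Z (j - 2)" if "z \<in> Z j" for j z
    using that uvar_gchains[of z D i j] unfolding Z_def mem_Collect_eq diff_scale_chain by (simp add: fun_eq_iff)
  define \<psi> where "\<psi> = induced_map (filtered_chains D i) B' at_one"
  have at_one_B: "at_one ` B j \<subseteq> B'" for j
    unfolding B_def B'_def by (auto simp: at_one_diff intro!: imageI at_one_gchains)
  have psi: "\<psi> (coset (B j) z) = coset B' (at_one z)" for j z
    unfolding \<psi>_def filtered_chains_eq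
    by (rule induced_map_coset[OF B B' at_one_add at_one_B])
  have at_one_Z: "at_one z \<in> Z'" if "z \<in> Z j" for j z
    using that unfolding Z_def Z'_def
    by (auto simp: at_one_gchains simp flip: at_one_diff) (simp add: at_one_def fun_eq_iff)
  have smult_Z: "(\<lambda>s. smult c (z s)) \<in> Z j" if "z \<in> Z j" for c j z
  proof -
    have "(\<lambda>s. smult c (z s)) = 0 \<or> (\<lambda>s. smult c (z s)) = z" by (cases c) (auto simp: fun_eq_iff)
    then show ?thesis using that Z[of j] unfolding add_subgroup_def by metis
  qed
  \<comment> \<open>such that \<open>2k + \<gamma>\<close> is a lower bound for all \<open>q\<close>-gradings whenever \<open>k \<le> K\<close>; the \<open>2\<close> absorbs \<open>\<gamma>\<close>\<close>
  define K where "K = (Min (insert 0 (qdeg D ` states D)) - 2) div 2"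
  have bij: "bij_betw \<psi> (carrier (BN D i (2 * k + \<gamma>))) (carrier (BN_filtered D i))" if "k \<le> K" for k
  proof -
    define j where "j = 2 * k + \<gamma>"
    have j: "j \<le> qdeg D s \<and> even (qdeg D s - j)" if s: "s \<in> states D" for s
    proof
      have "Min (insert 0 (qdeg D ` states D)) \<le> qdeg D s" using fin s by (intro Min_le) auto
      moreover have "\<gamma> \<le> 1" by (simp add: \<gamma>_def)
      ultimately show "j \<le> qdeg D s" using \<open>k \<le> K\<close> unfolding j_def K_def by linarith
      show "even (qdeg D s - j)" using parity[OF s] by (simp add: j_def \<gamma>_def)
    qed
    have surj: "\<exists>f\<in>gchains D i' j. at_one f = g" if "g \<in> fchains D i'" for g i'
      using at_one_surj[OF that j] .
    have "inj_on \<psi> (coset (B j) ` Z j)"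
    proof (intro inj_onI; clarify)
      fix y z assume y: "y \<in> Z j" and z: "z \<in> Z j"
        and eq: "\<psi> (coset (B j) y) = \<psi> (coset (B j) z)"
      then have "at_one (y - z) \<in> B'"
        unfolding psi coset_eq_iff[OF B'] at_one_minus by simp
      then obtain g where g: "g \<in> fchains D (i - 1)" "at_one (y - z) = diff 1 D g"
        by (auto simp: B'_def)
      from surj[OF g(1)] obtain f where f: "f \<in> gchains D (i - 1) j" "at_one f = g" by blast
      have "y - z - diff uvar D f \<in> gchains D i j"
        using y z diff_gchains[OF hom f(1)] add_subgroup_gchains[of D i j]
        by (auto simp: Z_def add_subgroup_def)
      moreover have "at_one (y - z - diff uvar D f) = 0"
        using f g by (simp add: at_one_minus[of _ "diff uvar D f"] at_one_diff)
      ultimately have "y - z = diff uvar D f" using at_one_eq_0 by fastforce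
      then show "coset (B j) y = coset (B j) z"
        unfolding coset_eq_iff[OF B] using f by (auto simp: B_def)
    qed
    moreover have "\<psi> ` coset (B j) ` Z j = coset B' ` Z'"
    proof
      show "\<psi> ` coset (B j) ` Z j \<subseteq> coset B' ` Z'" by (auto simp: psi at_one_Z)
      show "coset B' ` Z' \<subseteq> \<psi> ` coset (B j) ` Z j"
      proof clarify
        fix g assume "g \<in> Z'"
        then have g: "g \<in> fchains D i" "diff 1 D g = 0" by (auto simp: Z'_def)
        from surj[OF g(1)] obtain f where f: "f \<in> gchains D i j" "at_one f = g" by blast
        have "diff uvar D f = 0"
          by (rule at_one_eq_0[OF diff_gchains[OF hom f(1)]]) (simp add: at_one_diff f g)
        with f have "f \<in> Z j" by (simp add: Z_def)
        with f show "coset B' g \<in> \<psi> ` coset (B j) ` Z j"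
          by (auto simp: image_iff psi intro!: bexI[of _ f])
      qed
    qed
    ultimately show ?thesis unfolding carrier_BN carrier_F j_def[symmetric] bij_betw_def by blast
  qed
  show ?thesis
    unfolding BN_stable_def Let_def \<gamma>_def[symmetric]
  proof (rule direct_limit_isomorphic[where \<psi> = "\<lambda>_. \<psi>" and K = K])
    fix k x assume "x \<in> carrier (BN D i (2 * k + \<gamma>))"
    then obtain z where z: "z \<in> Z (2 * k + \<gamma>)" "x = coset (B (2 * k + \<gamma>)) z"
      unfolding carrier_BN by blast
    have k: "2 * (k - 1) + \<gamma> = 2 * k + \<gamma> - 2" by simp
    show "u_star D i (2 * k + \<gamma>) x \<in> carrier (BN D i (2 * (k - 1) + \<gamma>))"
      unfolding k carrier_BN z u_star using z uZ by blast
    show "\<psi> x \<in> carrier (BN_filtered D i)"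
      unfolding z psi carrier_F using z at_one_Z by blast
    show "\<psi> (u_star D i (2 * k + \<gamma>) x) = \<psi> x"
      unfolding z u_star psi at_one_uvar ..
    fix c
    show "c \<odot>\<^bsub>BN D i (2 * k + \<gamma>)\<^esub> x \<in> carrier (BN D i (2 * k + \<gamma>))"
      unfolding z smult_BN carrier_BN using z smult_Z by blast
    show "\<psi> (c \<odot>\<^bsub>BN D i (2 * k + \<gamma>)\<^esub> x) = c \<odot>\<^bsub>BN_filtered D i\<^esub> \<psi> x"
      unfolding z smult_BN psi smult_F by (simp add: at_one_def)
  next
    fix k x y assume "x \<in> carrier (BN D i (2 * k + \<gamma>))" "y \<in> carrier (BN D i (2 * k + \<gamma>))"
    then obtain v w where z: "v \<in> Z (2 * k + \<gamma>)" "x = coset (B (2 * k + \<gamma>)) v"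
      "w \<in> Z (2 * k + \<gamma>)" "y = coset (B (2 * k + \<gamma>)) w"
      unfolding carrier_BN by blast
    show "x \<oplus>\<^bsub>BN D i (2 * k + \<gamma>)\<^esub> y \<in> carrier (BN D i (2 * k + \<gamma>))"
      unfolding z add_BN carrier_BN using z add_subgroup_add[OF Z] by blast
    show "\<psi> (x \<oplus>\<^bsub>BN D i (2 * k + \<gamma>)\<^esub> y) = \<psi> x \<oplus>\<^bsub>BN_filtered D i\<^esub> \<psi> y"
      unfolding z add_BN psi at_one_add add_F ..
  qed (fact bij)
qed

section \<open>Merging and splitting the cycles of a permutation\<close>

lemma equivclp_least:
  assumes "equivclp R x y" and "\<And>x y. R x y \<Longrightarrow> T x y" and "equivp T"
  shows "T x y"
  using assms(1)
proof (induction rule: equivclp_induct)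
  case base
  show ?case using assms(3) by (simp add: equivp_reflp)
next
  case (step y z)
  then show ?case using assms(2,3) by (meson equivp_symp equivp_transp)
qed

lemma equivclp_step: "R x y \<Longrightarrow> equivclp R x y"
  by (simp add: r_into_equivclp)

lemma equivclp_mono:
  assumes "\<And>x y. R x y \<Longrightarrow> equivclp R' x y"
  shows "equivclp R x y \<Longrightarrow> equivclp R' x y"
  by (erule equivclp_least) (use assms in auto)

text \<open>
  How the circles change when two of them are merged. Only the generated equivalences matter here,
  so that a symmetric description of the circles and one by an orientation are interchangeable.
\<close>

definition joins :: "('a \<Rightarrow> 'a \<Rightarrow> bool) \<Rightarrow> ('a \<Rightarrow> 'a \<Rightarrow> bool) \<Rightarrow> 'a \<Rightarrow> 'a \<Rightarrow> bool" where
  "joins R R' a c \<longleftrightarrow> \<not> equivclp R a c \<and>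
     (\<forall>x y. equivclp R' x y \<longleftrightarrow> equivclp R x y \<or>
        (equivclp R a x \<or> equivclp R c x) \<and> (equivclp R a y \<or> equivclp R c y))"

lemma joins_sym: "joins R R' a c \<Longrightarrow> joins R R' c a"
  unfolding joins_def by (blast intro: equivclp_sym)

definition class_in :: "'a set \<Rightarrow> ('a \<Rightarrow> 'a \<Rightarrow> bool) \<Rightarrow> 'a \<Rightarrow> 'a set" where
  "class_in S R x = {y \<in> S. equivclp R x y}"

lemma generated_classes_eq: "generated_classes S R = class_in S R ` S"
  unfolding generated_classes_def class_in_def quotient_def by auto

lemma class_in_eq_iff:
  assumes "y \<in> S"
  shows "class_in S R x = class_in S R y \<longleftrightarrow> equivclp R x y"
proof
  assume "class_in S R x = class_in S R y"
  then have "y \<in> class_in S R x" using assms by (simp add: class_in_def)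
  then show "equivclp R x y" by (simp add: class_in_def)
next
  assume "equivclp R x y"
  then show "class_in S R x = class_in S R y"
    unfolding class_in_def by (blast intro: equivclp_trans equivclp_sym)
qed

lemma joins_classes:
  assumes j: "joins R R' a c" and a: "a \<in> S" and c: "c \<in> S"
  defines "P \<equiv> class_in S R a" and "P' \<equiv> class_in S R c"
  shows "P \<noteq> P'" "class_in S R' a = P \<union> P'" "class_in S R' c = P \<union> P'"
    and "P \<in> generated_classes S R" "P' \<in> generated_classes S R"
    and "P \<union> P' \<notin> generated_classes S R"
    and "generated_classes S R' = insert (P \<union> P') (generated_classes S R - {P, P'})"
proof -
  have nac: "\<not> equivclp R a c" using j by (simp add: joins_def)
  show neq: "P \<noteq> P'" unfolding P_def P'_def class_in_eq_iff[OF c] by (rule nac)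
  have R': "equivclp R' x y \<longleftrightarrow> equivclp R x y \<or>
        (equivclp R a x \<or> equivclp R c x) \<and> (equivclp R a y \<or> equivclp R c y)" for x y
    using j by (simp add: joins_def)
  have merged: "class_in S R' x = P \<union> P'" if "equivclp R a x \<or> equivclp R c x" for x
    using that unfolding class_in_def P_def P'_def R'
    by (blast intro: equivclp_trans equivclp_sym)
  have unchanged: "class_in S R' x = class_in S R x" if "\<not> (equivclp R a x \<or> equivclp R c x)" for x
    using that unfolding class_in_def R' by blast
  show "class_in S R' a = P \<union> P'" "class_in S R' c = P \<union> P'" by (simp_all add: merged)
  show PP: "P \<in> generated_classes S R" "P' \<in> generated_classes S R"
    unfolding generated_classes_eq P_def P'_def using a c by auto
  have aP: "a \<in> P" "c \<in> P'" using a c by (simp_all add: P_def P'_def class_in_def)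
  show "P \<union> P' \<notin> generated_classes S R"
  proof
    assume "P \<union> P' \<in> generated_classes S R"
    then obtain x where "P \<union> P' = class_in S R x" by (auto simp: generated_classes_eq)
    with aP have "equivclp R x a" "equivclp R x c" by (auto simp: class_in_def)
    with nac show False by (blast intro: equivclp_trans equivclp_sym)
  qed
  show "generated_classes S R' = insert (P \<union> P') (generated_classes S R - {P, P'})"
  proof
    show "generated_classes S R' \<subseteq> insert (P \<union> P') (generated_classes S R - {P, P'})"
    proof
      fix C assume "C \<in> generated_classes S R'"
      then obtain x where x: "x \<in> S" "C = class_in S R' x" by (auto simp: generated_classes_eq)
      show "C \<in> insert (P \<union> P') (generated_classes S R - {P, P'})"
      proof (cases "equivclp R a x \<or> equivclp R c x")
        case True
        then show ?thesis by (simp add: x merged)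
      next
        case False
        then have "class_in S R x \<noteq> P" "class_in S R x \<noteq> P'"
          unfolding P_def P'_def class_in_eq_iff[OF a] class_in_eq_iff[OF c]
          by (blast intro: equivclp_sym)+
        then show ?thesis using x False by (simp add: unchanged generated_classes_eq)
      qed
    qed
    show "insert (P \<union> P') (generated_classes S R - {P, P'}) \<subseteq> generated_classes S R'"
    proof
      fix C assume "C \<in> insert (P \<union> P') (generated_classes S R - {P, P'})"
      then consider "C = P \<union> P'" | x where "x \<in> S" "C = class_in S R x" "C \<noteq> P" "C \<noteq> P'"
        by (auto simp: generated_classes_eq)
      then show "C \<in> generated_classes S R'"
      proof cases
        case 1
        then have "C = class_in S R' a" by (simp add: merged)
        with a show ?thesis by (simp add: generated_classes_eq)
      next
        case 2
        then have "\<not> (equivclp R a x \<or> equivclp R c x)"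
          unfolding P_def P'_def by (metis class_in_eq_iff)
        then have "C = class_in S R' x" by (simp add: unchanged 2)
        with \<open>x \<in> S\<close> show ?thesis unfolding generated_classes_eq by blast
      qed
    qed
  qed
qed

lemma card_joins:
  assumes j: "joins R R' a c" and a: "a \<in> S" and c: "c \<in> S" and "finite S"
  shows "card (generated_classes S R) = Suc (card (generated_classes S R'))"
proof -
  note J = joins_classes[OF j a c]
  have "finite (generated_classes S R)" using \<open>finite S\<close> by (simp add: generated_classes_eq)
  moreover have "card {class_in S R a, class_in S R c} = 2" using J(1) by simp
  moreover have "card (generated_classes S R) \<ge> card {class_in S R a, class_in S R c}"
    using J(4,5) \<open>finite (generated_classes S R)\<close> by (intro card_mono) auto
  ultimately show ?thesis
    unfolding J(7) using J(4,5,6) by (simp add: card_Diff_subset)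
qed

abbreviation (input) graph_of :: "('a \<Rightarrow> 'a) \<Rightarrow> 'a \<Rightarrow> 'a \<Rightarrow> bool" where
  "graph_of f \<equiv> (\<lambda>x y. y = f x)"

lemma equivclp_funpow: "equivclp (graph_of f) x ((f ^^ m) x)"
proof (induction m)
  case (Suc m)
  then show ?case by (auto intro: equivclp_trans equivclp_step)
qed simp

text \<open>
  A step backwards along \<open>f\<close> can be replaced by steps forwards, because every point returns to itself.
\<close>

lemma equivclp_permutation:
  assumes "permutation f" and "equivclp (graph_of f) x y"
  shows "\<exists>m. y = (f ^^ m) x"
  using assms(2)
proof (induction rule: equivclp_induct)
  case base
  show ?case by (intro exI[of _ 0]) simp
next
  case (step y z)
  then obtain m where m: "y = (f ^^ m) x" by blast
  from step(2) show ?case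
  proof
    assume "z = f y"
    with m show ?thesis by (intro exI[of _ "Suc m"]) simp
  next
    assume y: "y = f z"
    obtain n where n: "n > 0" "(f ^^ n) z = z" using permutation_self[OF assms(1)] .
    then obtain k where k: "n = Suc k" by (cases n) auto
    have "z = (f ^^ k) y" using n(2) unfolding k y by (simp add: funpow_swap1)
    then have "z = (f ^^ (k + m)) x" by (simp add: m funpow_add)
    then show ?thesis by blast
  qed
qed

text \<open>
  After composition with the transposition, \<open>c\<close> is sent to where \<open>a\<close> went, and from there on its path
  is the old path of \<open>a\<close> up to the first visit to \<open>a\<close> or \<open>c\<close>.
\<close>

lemma funpow_transpose:
  fixes f :: "'a \<Rightarrow> 'a"
  assumes avoid: "\<And>j. 0 < j \<Longrightarrow> j < n \<Longrightarrow> (f ^^ j) a \<notin> {a, c}" and "0 < j" "j \<le> n"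
  defines "g \<equiv> f \<circ> Transposition.transpose a c"
  shows "(g ^^ j) c = (f ^^ j) a"
proof -
  have g: "g c = f a" "x \<notin> {a, c} \<Longrightarrow> g x = f x" for x
    by (auto simp: g_def Transposition.transpose_def)
  show ?thesis
    using \<open>0 < j\<close> \<open>j \<le> n\<close>
  proof (induction j)
    case (Suc j)
    show ?case
    proof (cases "j = 0")
      case False
      with Suc have "(g ^^ j) c = (f ^^ j) a" "(f ^^ j) a \<notin> {a, c}" using avoid by auto
      then show ?thesis by (simp add: g)
    qed (simp add: g)
  qed simp
qed

text \<open>
  The cycle of \<open>a\<close> does not meet \<open>c\<close>. In the new permutation \<open>c\<close> enters this cycle and runs through it
  until it reaches \<open>a\<close>, which is sent to the old cycle of \<open>c\<close>.
\<close>

lemma joins_first_return: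
  assumes f: "permutation f" and ac: "a \<noteq> c"
    and n: "n > 0" "(f ^^ n) a = a" and avoid: "\<And>j. 0 < j \<Longrightarrow> j < n \<Longrightarrow> (f ^^ j) a \<notin> {a, c}"
  shows "joins (graph_of f) (graph_of (f \<circ> Transposition.transpose a c)) a c"
proof -
  define g where "g = f \<circ> Transposition.transpose a c"
  let ?F = "equivclp (graph_of f)" and ?G = "equivclp (graph_of g)"
  have g: "g a = f c" "g c = f a" "x \<notin> {a, c} \<Longrightarrow> g x = f x" for x
    by (auto simp: g_def Transposition.transpose_def)
  have nac: "\<not> ?F a c"
  proof
    assume "?F a c"
    then obtain m where "c = (f ^^ m) a" using equivclp_permutation[OF f] by blast
    then have "c = (f ^^ (m mod n)) a" using funpow_mod_eq[OF n(2)] by simp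
    moreover have "m mod n < n" using n(1) by simp
    ultimately show False using avoid[of "m mod n"] ac by (cases "m mod n = 0") auto
  qed
  have "(g ^^ n) c = a" using funpow_transpose[OF avoid, of n n] n unfolding g_def by simp
  then have Gca: "?G c a" using equivclp_funpow[of g c n] by simp
  have FG: "?G x y" if "?F x y" for x y
  proof (rule equivclp_mono[OF _ that])
    fix x y assume y: "y = f x"
    consider "x = a" | "x = c" | "x \<notin> {a, c}" by blast
    then show "?G x y"
    proof cases
      case 1
      have "?G c (g c)" by (rule equivclp_step) simp
      then show ?thesis using Gca unfolding 1 y g by (blast intro: equivclp_trans equivclp_sym)
    next
      case 2
      have "?G a (g a)" by (rule equivclp_step) simp
      then show ?thesis using Gca unfolding 2 y g by (blast intro: equivclp_trans equivclp_sym)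
    next
      case 3
      have "?G x (g x)" by (rule equivclp_step) simp
      then show ?thesis unfolding y g(3)[OF 3] .
    qed
  qed
  define U where "U x \<longleftrightarrow> ?F a x \<or> ?F c x" for x
  have U: "U x \<Longrightarrow> ?F x y \<Longrightarrow> U y" for x y
    unfolding U_def by (blast intro: equivclp_trans)
  have UG: "U x \<Longrightarrow> ?G a x" for x
    unfolding U_def using FG Gca by (blast intro: equivclp_trans equivclp_sym)
  have "?G x y \<longleftrightarrow> ?F x y \<or> U x \<and> U y" for x y
  proof
    assume "?F x y \<or> U x \<and> U y"
    then show "?G x y" using FG UG by (blast intro: equivclp_trans equivclp_sym)
  next
    assume "?G x y"
    then show "?F x y \<or> U x \<and> U y"
    proof (rule equivclp_least)
      fix x y assume y: "y = g x"
      have step: "?F a (f a)" "?F c (f c)" "?F x (f x)" by (auto intro: equivclp_step)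
      consider "x = a" | "x = c" | "x \<notin> {a, c}" by blast
      then show "?F x y \<or> U x \<and> U y"
        by cases (use step in \<open>auto simp: y g U_def\<close>)
    next
      show "equivp (\<lambda>x y. ?F x y \<or> U x \<and> U y)"
      proof (intro equivpI reflpI sympI transpI)
        show "?F x x \<or> U x \<and> U x" for x by simp
        show "?F y x \<or> U y \<and> U x" if "?F x y \<or> U x \<and> U y" for x y
          using that by (blast intro: equivclp_sym)
        show "?F x z \<or> U x \<and> U z" if "?F x y \<or> U x \<and> U y" "?F y z \<or> U y \<and> U z" for x y z
          using that U by (blast intro: equivclp_sym equivclp_trans)
      qed
    qed
  qed
  then show ?thesis
    unfolding joins_def using nac by (simp add: g_def U_def)
qed

text \<open>
  Follow \<open>f\<close> from \<open>a\<close> to the first visit to \<open>a\<close> or \<open>c\<close>. If it is a visit to \<open>a\<close>, then \<open>a\<close> and \<open>c\<close> are on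
  different cycles of \<open>f\<close>, which are merged. If it is a visit to \<open>c\<close>, then under \<open>g\<close> the path from \<open>c\<close>
  closes up at this place without meeting \<open>a\<close>, and \<open>f\<close>, which is \<open>g\<close> composed with the same
  transposition, merges two cycles of \<open>g\<close>.
\<close>

lemma joins_transpose:
  assumes f: "permutation f" and ac: "a \<noteq> c"
  defines "g \<equiv> f \<circ> Transposition.transpose a c"
  shows "joins (graph_of f) (graph_of g) a c \<or> joins (graph_of g) (graph_of f) a c"
proof -
  obtain n0 where n0: "n0 > 0" "(f ^^ n0) a = a" using permutation_self[OF f] .
  define n where "n = (LEAST n. 0 < n \<and> (f ^^ n) a \<in> {a, c})"
  have n: "0 < n \<and> (f ^^ n) a \<in> {a, c}"
    unfolding n_def by (rule LeastI[of _ n0]) (use n0 in simp)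
  have avoid: "(f ^^ j) a \<notin> {a, c}" if "0 < j" "j < n" for j
    using not_less_Least[of j "\<lambda>n. 0 < n \<and> (f ^^ n) a \<in> {a, c}"] that unfolding n_def by blast
  show ?thesis
  proof (cases "(f ^^ n) a = a")
    case True
    then show ?thesis
      using joins_first_return[OF f ac _ True avoid] n unfolding g_def by blast
  next
    case False
    with n have fna: "(f ^^ n) a = c" by auto
    have iter: "(g ^^ j) c = (f ^^ j) a" if "0 < j" "j \<le> n" for j
      unfolding g_def using funpow_transpose[OF avoid that] .
    have "permutation g"
      unfolding g_def by (intro permutation_compose f permutation_swap_id)
    moreover have "(g ^^ n) c = c" using iter[of n] n fna by simp
    moreover have "(g ^^ j) c \<notin> {c, a}" if "0 < j" "j < n" for j
      using iter[of j] avoid[of j] that by auto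
    ultimately have "joins (graph_of g) (graph_of (g \<circ> Transposition.transpose c a)) c a"
      using joins_first_return[of g c a n] ac n by blast
    moreover have "g \<circ> Transposition.transpose c a = f"
      by (auto simp: g_def fun_eq_iff Transposition.transpose_def)
    ultimately show ?thesis using joins_sym by metis
  qed
qed

lemma card_classes_parity:
  assumes "finite X" and "finite S"
    and base: "a ` X \<subseteq> S" "c ` X \<subseteq> S"
    and toggle: "\<And>Y r. r \<in> X \<Longrightarrow> Y \<subseteq> X \<Longrightarrow> r \<notin> Y \<Longrightarrow>
      joins (F Y) (F (insert r Y)) (a r) (c r) \<or> joins (F (insert r Y)) (F Y) (a r) (c r)"
  shows "even (card (generated_classes S (F X)) + card X) \<longleftrightarrow> even (card (generated_classes S (F {})))"
proof -
  have "even (card (generated_classes S (F Y)) + card Y) \<longleftrightarrow> even (card (generated_classes S (F {})))"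
    if "finite Y" "Y \<subseteq> X" for Y
    using that
  proof (induction Y rule: finite_induct)
    case (insert r Y)
    then have r: "r \<in> X" "Y \<subseteq> X" "r \<notin> Y" by auto
    have "a r \<in> S" "c r \<in> S" using base r by auto
    then have "card (generated_classes S (F Y)) = Suc (card (generated_classes S (F (insert r Y)))) \<or>
      card (generated_classes S (F (insert r Y))) = Suc (card (generated_classes S (F Y)))"
      using toggle[OF r] \<open>finite S\<close> card_joins[of "F Y" "F (insert r Y)" "a r" "c r" S]
        card_joins[of "F (insert r Y)" "F Y" "a r" "c r" S] by blast
    then show ?case using insert by auto
  qed simp
  then show ?thesis using \<open>finite X\<close> by blast
qed

section \<open>Oriented systems of crossings\<close>

text \<open>
  Crossing \<open>r\<close> has the incoming arcs \<open>inc r k\<close> and the outgoing arcs \<open>out r k\<close>. The crossings in \<open>X\<close> are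
  those at which the two connections are exchanged.
\<close>

definition flow :: "nat \<Rightarrow> (nat \<Rightarrow> bool \<Rightarrow> 'e) \<Rightarrow> (nat \<Rightarrow> bool \<Rightarrow> 'e) \<Rightarrow> nat set \<Rightarrow> 'e \<Rightarrow> 'e \<Rightarrow> bool" where
  "flow n inc out X e f \<longleftrightarrow> (\<exists>r<n. \<exists>k. e = inc r k \<and> f = out r (k \<noteq> (r \<in> X)))"

locale two_in_two_out =
  fixes n :: nat and inc out :: "nat \<Rightarrow> bool \<Rightarrow> 'e"
  assumes inj_inc: "inj_on (case_prod inc) ({..<n} \<times> UNIV)"
    and inj_out: "inj_on (case_prod out) ({..<n} \<times> UNIV)"
    and same_ends: "case_prod inc ` ({..<n} \<times> UNIV) = case_prod out ` ({..<n} \<times> UNIV)"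
begin

definition touched :: "'e set" where "touched = case_prod inc ` ({..<n} \<times> UNIV)"

text \<open>
  The permutation whose cycles are the classes generated by \<open>flow\<close>. An arc that meets no crossing
  forms a class of its own, so it has to be a fixed point.
\<close>

definition next_end :: "nat set \<Rightarrow> 'e \<Rightarrow> 'e" where
  "next_end X e = (if e \<in> touched
     then case inv_into ({..<n} \<times> UNIV) (case_prod inc) e of (r, k) \<Rightarrow> out r (k \<noteq> (r \<in> X))
     else e)"

lemma inc_touched: "r < n \<Longrightarrow> inc r k \<in> touched"
  unfolding touched_def by force

lemma out_touched: "r < n \<Longrightarrow> out r k \<in> touched"
  unfolding touched_def same_ends by force

lemma touched_cases: assumes "e \<in> touched" obtains r k where "r < n" "e = inc r k"
  using assms unfolding touched_def by auto

lemma inc_eq_iff: "r < n \<Longrightarrow> s < n \<Longrightarrow> inc r k = inc s l \<longleftrightarrow> r = s \<and> k = l"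
  using inj_onD[OF inj_inc, of "(r, k)" "(s, l)"] by auto

lemma out_eq_iff: "r < n \<Longrightarrow> s < n \<Longrightarrow> out r k = out s l \<longleftrightarrow> r = s \<and> k = l"
  using inj_onD[OF inj_out, of "(r, k)" "(s, l)"] by auto

lemma next_end_inc: assumes r: "r < n" shows "next_end X (inc r k) = out r (k \<noteq> (r \<in> X))"
proof -
  have "inv_into ({..<n} \<times> UNIV) (case_prod inc) (case_prod inc (r, k)) = (r, k)"
    by (rule inv_into_f_f[OF inj_inc]) (use r in simp)
  then show ?thesis using inc_touched[OF r] by (simp add: next_end_def)
qed

lemma next_end_outside: "e \<notin> touched \<Longrightarrow> next_end X e = e"
  by (simp add: next_end_def)

lemma permutation_next_end: "permutation (next_end X)"
proof -
  have fin: "finite touched" by (simp add: touched_def)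
  have inj: "inj_on (next_end X) touched"
  proof (rule inj_onI)
    fix e f assume "e \<in> touched" "f \<in> touched" and eq: "next_end X e = next_end X f"
    then obtain r k s l where "r < n" "e = inc r k" "s < n" "f = inc s l" by (auto elim!: touched_cases)
    with eq have "out r (k \<noteq> (r \<in> X)) = out s (l \<noteq> (s \<in> X))" by (simp add: next_end_inc)
    then have "r = s" "(k \<noteq> (r \<in> X)) = (l \<noteq> (s \<in> X))"
      unfolding out_eq_iff[OF \<open>r < n\<close> \<open>s < n\<close>] by auto
    then show "e = f" using \<open>e = inc r k\<close> \<open>f = inc s l\<close> by (cases k; cases l) auto
  qed
  have "next_end X ` touched \<subseteq> touched"
    by (auto elim!: touched_cases simp: next_end_inc out_touched)
  with inj fin have "next_end X ` touched = touched" by (simp add: endo_inj_surj)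
  with inj have "next_end X permutes touched"
    by (intro bij_imp_permutes) (auto simp: bij_betw_def next_end_outside)
  with fin show ?thesis by (rule permutes_imp_permutation)
qed

lemma equivclp_flow: "equivclp (flow n inc out X) = equivclp (graph_of (next_end X))"
proof (intro ext iffI)
  fix e f
  assume "equivclp (flow n inc out X) e f"
  then show "equivclp (graph_of (next_end X)) e f"
    by (rule equivclp_mono[rotated]) (auto simp: flow_def next_end_inc intro!: equivclp_step)
next
  fix e f
  assume "equivclp (graph_of (next_end X)) e f"
  then show "equivclp (flow n inc out X) e f"
  proof (rule equivclp_mono[rotated])
    fix e f assume f: "f = next_end X e"
    show "equivclp (flow n inc out X) e f"
    proof (cases "e \<in> touched")
      case True
      then obtain r k where "r < n" "e = inc r k" by (rule touched_cases)
      then have "flow n inc out X e f" unfolding f flow_def by (auto simp: next_end_inc)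
      then show ?thesis by (rule equivclp_step)
    qed (simp add: f next_end_outside)
  qed
qed

lemma next_end_toggle:
  assumes r: "r < n" "r \<notin> X"
  shows "next_end (insert r X) = next_end X \<circ> Transposition.transpose (inc r False) (inc r True)"
proof
  fix e
  show "next_end (insert r X) e = (next_end X \<circ> Transposition.transpose (inc r False) (inc r True)) e"
  proof (cases "e \<in> touched")
    case True
    then obtain s l where s: "s < n" "e = inc s l" by (rule touched_cases)
    show ?thesis
      using r s by (cases l) (auto simp: next_end_inc Transposition.transpose_def inc_eq_iff)
  next
    case False
    then have "e \<noteq> inc r False" "e \<noteq> inc r True" using inc_touched[OF r(1)] by auto
    with False show ?thesis by (simp add: next_end_outside)
  qed
qed

lemma joins_flow:
  assumes r: "r < n" "r \<notin> X"
  defines "a \<equiv> inc r False" and "c \<equiv> inc r True"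
  shows "joins (flow n inc out X) (flow n inc out (insert r X)) a c \<or>
    joins (flow n inc out (insert r X)) (flow n inc out X) a c"
proof -
  have "a \<noteq> c" using r by (simp add: a_def c_def inc_eq_iff)
  from joins_transpose[OF permutation_next_end[of X] this] show ?thesis
    unfolding joins_def equivclp_flow a_def c_def next_end_toggle[OF r] .
qed

lemma card_flow_classes:
  assumes "finite S" "touched \<subseteq> S" "X \<subseteq> {..<n}"
  shows "even (card (generated_classes S (flow n inc out X)) + card X) \<longleftrightarrow>
    even (card (generated_classes S (flow n inc out {})))"
proof (rule card_classes_parity[where a = "\<lambda>r. inc r False" and c = "\<lambda>r. inc r True"])
  show "finite X" using assms(3) finite_subset by blast
  show "(\<lambda>r. inc r False) ` X \<subseteq> S" "(\<lambda>r. inc r True) ` X \<subseteq> S" using assms(2,3) inc_touched by auto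
  show "finite S" by (fact assms(1))
  fix Y r assume "r \<in> X" "Y \<subseteq> X" "r \<notin> Y"
  with assms(3) show "joins (flow n inc out Y) (flow n inc out (insert r Y)) (inc r False) (inc r True) \<or>
      joins (flow n inc out (insert r Y)) (flow n inc out Y) (inc r False) (inc r True)"
    by (intro joins_flow) auto
qed

end

section \<open>Counting over the field with two elements\<close>

text \<open>
  The vector space over \<open>\<bbbF>\<^sub>2\<close> with basis \<open>A\<close>, as functions on the whole type.
\<close>

definition supp_in :: "'a set \<Rightarrow> ('a \<Rightarrow> bit) set" where
  "supp_in A = {f. \<forall>x. x \<notin> A \<longrightarrow> f x = 0}"

definition point :: "'a \<Rightarrow> 'a \<Rightarrow> bit" where
  "point x y = of_bool (y = x)"

definition invariant :: "'a set \<Rightarrow> ('a \<Rightarrow> 'a \<Rightarrow> bool) \<Rightarrow> ('a \<Rightarrow> bit) set" where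
  "invariant S R = {f \<in> supp_in S. \<forall>x y. R x y \<longrightarrow> f x = f y}"

lemma bit_cases_of_bool: "(b::bit) = of_bool (b \<noteq> 0)"
  by (cases b) simp_all

lemma bit_fun_add_self: "(f :: 'a \<Rightarrow> bit) + f = 0"
  by (simp add: fun_eq_iff)

lemma bit_fun_diff: "(f :: 'a \<Rightarrow> bit) - g = f + g"
  by (simp add: fun_eq_iff)

lemma add_subgroup_bitI:
  fixes G :: "('a \<Rightarrow> bit) set"
  assumes "0 \<in> G" "\<And>f g. f \<in> G \<Longrightarrow> g \<in> G \<Longrightarrow> f + g \<in> G"
  shows "add_subgroup G"
  using assms unfolding add_subgroup_def bit_fun_diff by blast

lemma add_subgroup_supp_in: "add_subgroup (supp_in A)"
  by (rule add_subgroup_bitI) (auto simp: supp_in_def)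

lemma add_subgroup_invariant: "add_subgroup (invariant S R)"
  by (rule add_subgroup_bitI) (auto simp: invariant_def supp_in_def)

lemma card_supp_in:
  assumes "finite A"
  shows "card (supp_in A) = 2 ^ card A" "finite (supp_in A)"
proof -
  have "bij_betw (\<lambda>X x. of_bool (x \<in> X)) (Pow A) (supp_in A)"
  proof (rule bij_betwI[where g = "\<lambda>f. {x. f x \<noteq> 0}"])
    show "(\<lambda>X x. of_bool (x \<in> X)) \<in> Pow A \<rightarrow> supp_in A"
      by (auto simp: supp_in_def)
    show "(\<lambda>f. {x. f x \<noteq> 0}) \<in> supp_in A \<rightarrow> Pow A"
      by (auto simp: supp_in_def)
    show "(\<lambda>x. of_bool (x \<in> {x. f x \<noteq> 0})) = f" if "f \<in> supp_in A" for f :: "'a \<Rightarrow> bit"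
      by (simp add: fun_eq_iff flip: bit_cases_of_bool)
  qed simp
  then show "card (supp_in A) = 2 ^ card A" "finite (supp_in A)"
    using assms bij_betw_same_card[of _ "Pow A" "supp_in A"] bij_betw_finite[of _ "Pow A" "supp_in A"]
    by (auto simp: card_Pow)
qed

text \<open>
  An invariant function is the indicator function of a union of classes.
\<close>

lemma card_invariant:
  assumes "finite S" and R: "\<And>x y. R x y \<Longrightarrow> x \<in> S \<and> y \<in> S"
  shows "card (invariant S R) = 2 ^ card (generated_classes S R)" "finite (invariant S R)"
proof -
  let ?G = "generated_classes S R"
  have const: "f x = f y" if f: "f \<in> invariant S R" and "equivclp R x y" for f x y
    using that(2) by (induction rule: equivclp_induct) (use f in \<open>auto simp: invariant_def\<close>)
  have "bij_betw (\<lambda>X x. of_bool (x \<in> \<Union>X)) (Pow ?G) (invariant S R)"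
  proof (rule bij_betwI[where g = "\<lambda>f. {C \<in> ?G. \<exists>x\<in>C. f x \<noteq> 0}"])
    show "(\<lambda>X x. of_bool (x \<in> \<Union>X)) \<in> Pow ?G \<rightarrow> invariant S R"
    proof
      fix X assume "X \<in> Pow ?G"
      then have X: "C \<in> X \<Longrightarrow> \<exists>z\<in>S. C = class_in S R z" for C by (auto simp: generated_classes_eq)
      have "x \<in> \<Union>X \<longleftrightarrow> y \<in> \<Union>X" if xy: "R x y" for x y
      proof -
        have "equivclp R x y" "x \<in> S" "y \<in> S" using R[OF xy] xy by (auto intro: equivclp_step)
        then have "x \<in> class_in S R z \<longleftrightarrow> y \<in> class_in S R z" for z
          unfolding class_in_def by (blast intro: equivclp_trans equivclp_sym)
        then show ?thesis using X by (metis Union_iff)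
      qed
      moreover have "\<Union>X \<subseteq> S" using X by (fastforce simp: class_in_def)
      ultimately show "(\<lambda>x. of_bool (x \<in> \<Union>X)) \<in> invariant S R"
        unfolding invariant_def supp_in_def by auto
    qed
    show "{C \<in> ?G. \<exists>x\<in>C. of_bool (x \<in> \<Union>X) \<noteq> (0::bit)} = X" if X: "X \<in> Pow ?G" for X
    proof -
      have "C \<in> X" if C: "C \<in> ?G" "x \<in> C" "D \<in> X" "x \<in> D" for C D x
      proof -
        obtain y z where "y \<in> S" "C = class_in S R y" "z \<in> S" "D = class_in S R z"
          using C X by (auto simp: generated_classes_eq)
        moreover have "x \<in> S" "equivclp R y x" "equivclp R z x"
          using C calculation by (auto simp: class_in_def)
        ultimately have "C = D" by (metis class_in_eq_iff)
        with C show ?thesis by simp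
      qed
      moreover have "\<exists>x\<in>C. x \<in> \<Union>X" if C: "C \<in> X" for C
      proof -
        obtain z where "z \<in> S" "C = class_in S R z" using C X by (auto simp: generated_classes_eq)
        then have "z \<in> C" by (simp add: class_in_def)
        with C show ?thesis by blast
      qed
      ultimately show ?thesis using X by auto
    qed
    show "(\<lambda>x. of_bool (x \<in> \<Union>{C \<in> ?G. \<exists>x\<in>C. f x \<noteq> 0})) = f" if f: "f \<in> invariant S R" for f
    proof
      fix x
      have "x \<in> \<Union>{C \<in> ?G. \<exists>x\<in>C. f x \<noteq> 0} \<longleftrightarrow> f x \<noteq> 0"
      proof
        assume "x \<in> \<Union>{C \<in> ?G. \<exists>x\<in>C. f x \<noteq> 0}"
        then obtain z y where "equivclp R z x" "equivclp R z y" "f y \<noteq> 0"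
          by (auto simp: generated_classes_eq class_in_def)
        then show "f x \<noteq> 0" using const[OF f] by metis
      next
        assume nz: "f x \<noteq> 0"
        then have "x \<in> S" using f by (auto simp: invariant_def supp_in_def)
        then have "class_in S R x \<in> ?G" "x \<in> class_in S R x" by (auto simp: generated_classes_eq class_in_def)
        with nz show "x \<in> \<Union>{C \<in> ?G. \<exists>x\<in>C. f x \<noteq> 0}" by blast
      qed
      then show "of_bool (x \<in> \<Union>{C \<in> ?G. \<exists>x\<in>C. f x \<noteq> 0}) = f x"
        using bit_cases_of_bool[of "f x"] by simp
    qed
    show "(\<lambda>f. {C \<in> ?G. \<exists>x\<in>C. f x \<noteq> 0}) \<in> invariant S R \<rightarrow> Pow ?G" by blast
  qed
  moreover have "finite ?G" using \<open>finite S\<close> by (simp add: generated_classes_eq)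
  ultimately show "card (invariant S R) = 2 ^ card ?G" "finite (invariant S R)"
    using bij_betw_same_card[of _ "Pow ?G" "invariant S R"] bij_betw_finite[of _ "Pow ?G" "invariant S R"]
    by (auto simp: card_Pow)
qed

lemma add_subgroup_image:
  fixes T :: "'a::ab_group_add \<Rightarrow> 'b::ab_group_add"
  assumes G: "add_subgroup G" and T: "\<And>x y. T (x + y) = T x + T y"
  shows "add_subgroup (T ` G)"
proof -
  have T_diff: "T x - T y = T (x - y)" for x y using T[of "x - y" y] by simp
  then have "T 0 = 0" by (metis diff_self)
  with G show ?thesis unfolding add_subgroup_def by (force simp: T_diff)
qed

lemma add_subgroup_sums:
  assumes A: "add_subgroup A" and B: "add_subgroup B"
  shows "add_subgroup ((\<lambda>(a, b). a + b) ` (A \<times> B))"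
  unfolding add_subgroup_def
proof (intro conjI ballI)
  have "(0, 0) \<in> A \<times> B" using A B by (simp add: add_subgroup_def)
  then show "0 \<in> (\<lambda>(a, b). a + b) ` (A \<times> B)" by (rule rev_image_eqI) simp
next
  fix x y assume "x \<in> (\<lambda>(a, b). a + b) ` (A \<times> B)" "y \<in> (\<lambda>(a, b). a + b) ` (A \<times> B)"
  then obtain a b a' b' where xy: "x = a + b" "y = a' + b'" "a \<in> A" "b \<in> B" "a' \<in> A" "b' \<in> B" by auto
  then have "(a - a', b - b') \<in> A \<times> B" using A B by (simp add: add_subgroup_def)
  then show "x - y \<in> (\<lambda>(a, b). a + b) ` (A \<times> B)"
    by (rule rev_image_eqI) (simp add: xy add_diff_add)
qed

text \<open>
  Each fibre over the image is a translate of the kernel. This replaces the rank-nullity theorem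
  for finite spaces.
\<close>

lemma card_kernel_image:
  fixes T :: "'a::ab_group_add \<Rightarrow> 'b::ab_group_add"
  assumes G: "add_subgroup G" "finite G" and T: "\<And>x y. T (x + y) = T x + T y"
  shows "card G = card {x \<in> G. T x = 0} * card (T ` G)"
proof -
  have T_diff: "T (x - y) = T x - T y" for x y using T[of "x - y" y] by simp
  have fibre: "card {x \<in> G. T x = y} = card {x \<in> G. T x = 0}" if y: "y \<in> T ` G" for y
  proof -
    obtain x0 where x0: "x0 \<in> G" "y = T x0" using y by blast
    have "bij_betw (\<lambda>x. x - x0) {x \<in> G. T x = y} {x \<in> G. T x = 0}"
      by (rule bij_betwI[where g = "\<lambda>x. x + x0"])
        (use G(1) x0 add_subgroup_add[OF G(1)] in \<open>auto simp: T T_diff add_subgroup_def\<close>)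
    then show ?thesis by (rule bij_betw_same_card)
  qed
  have "card G = (\<Sum>y\<in>T ` G. card {x \<in> G. T x = y})"
    using sum.image_gen[OF G(2), of "\<lambda>_. 1::nat" T] by simp
  also have "\<dots> = (\<Sum>y\<in>T ` G. card {x \<in> G. T x = 0})" by (intro sum.cong refl fibre)
  finally show ?thesis by simp
qed

lemma supp_in_subset:
  fixes U :: "('a \<Rightarrow> bit) set"
  assumes "finite A" and U: "add_subgroup U" and "\<And>x. x \<in> A \<Longrightarrow> point x \<in> U"
  shows "supp_in A \<subseteq> U"
  using assms(1,3)
proof (induction A rule: finite_induct)
  case empty
  have "supp_in {} = {0 :: 'a \<Rightarrow> bit}" by (auto simp: supp_in_def fun_eq_iff)
  then show ?case using U by (simp add: add_subgroup_def)
next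
  case (insert x A)
  show ?case
  proof
    fix g assume g: "g \<in> supp_in (insert x A)"
    show "g \<in> U"
    proof (cases "g x = 0")
      case True
      with g have "g \<in> supp_in A" unfolding supp_in_def by auto
      with insert show ?thesis by auto
    next
      case False
      with g have "g + point x \<in> supp_in A" unfolding supp_in_def point_def by auto
      with insert have "g + point x \<in> U" "point x \<in> U" by auto
      then have "g + point x + point x \<in> U" by (rule add_subgroup_add[OF U])
      then show ?thesis by (simp add: add.assoc bit_fun_add_self)
    qed
  qed
qed

section \<open>Euler's formula and checkerboard colourings\<close>

definition arc_of :: "'e diagram \<Rightarrow> nat \<times> nat \<Rightarrow> 'e" where
  "arc_of D h = arc_at D (fst h) (snd h)"

text \<open>
  The other end of the same arc; the description is proper when every arc has exactly two ends.
\<close>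

definition opposite :: "'e diagram \<Rightarrow> nat \<times> nat \<Rightarrow> nat \<times> nat" where
  "opposite D h = (THE k. k \<in> half_edges D \<and> k \<noteq> h \<and> arc_of D k = arc_of D h)"

text \<open>
  In terms of corners: the corner to the left of \<open>turn h\<close> is the corner to the right of \<open>h\<close>.
\<close>

definition turn :: "nat \<times> nat \<Rightarrow> nat \<times> nat" where
  "turn h = (fst h, (snd h + 3) mod 4)"

definition paired_ends :: "'e diagram \<Rightarrow> bool" where
  "paired_ends D \<longleftrightarrow> (\<forall>h\<in>half_edges D. \<exists>!k. k \<in> half_edges D \<and> k \<noteq> h \<and> arc_of D k = arc_of D h)"

text \<open>
  \<open>W\<close> colours, for each arc end, the corner to its left. The left corners at the two ends of an arc are
  on different sides of the arc, so the second condition says that the arc separates the colours.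
\<close>

definition checkerboard :: "'e diagram \<Rightarrow> (nat \<times> nat \<Rightarrow> bool) \<Rightarrow> bool" where
  "checkerboard D W \<longleftrightarrow> (\<forall>h\<in>half_edges D. W (turn h) \<noteq> W h \<and> W (opposite D h) \<noteq> W h)"

lemma length_ends [simp]: "length (ends c) = 4"
  by (cases c) auto

lemma finite_half_edges [simp]: "finite (half_edges D)"
  by (simp add: half_edges_def)

lemma edges_eq: "edges D = arc_of D ` half_edges D"
proof -
  have "set (crossings D) = (\<lambda>r. crossings D ! r) ` {..<ncross D}"
    by (auto simp: set_conv_nth ncross_def)
  then have "edges D = (\<Union>r<ncross D. set (ends (crossings D ! r)))"
    unfolding edges_def by simp
  also have "\<dots> = (\<Union>r<ncross D. (\<lambda>p. arc_of D (r, p)) ` {..<4})"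
    by (intro SUP_cong refl) (auto simp: set_conv_nth arc_of_def)
  also have "\<dots> = arc_of D ` half_edges D"
    unfolding half_edges_def by blast
  finally show ?thesis .
qed

context
  fixes D :: "'e diagram"
  assumes paired: "paired_ends D"
begin

lemma opposite:
  assumes "h \<in> half_edges D"
  shows "opposite D h \<in> half_edges D" "opposite D h \<noteq> h" "arc_of D (opposite D h) = arc_of D h"
proof -
  have "\<exists>!k. k \<in> half_edges D \<and> k \<noteq> h \<and> arc_of D k = arc_of D h"
    using paired assms unfolding paired_ends_def by blast
  from theI'[OF this] show "opposite D h \<in> half_edges D" "opposite D h \<noteq> h" "arc_of D (opposite D h) = arc_of D h"
    unfolding opposite_def by auto
qed

lemma opposite_unique:
  assumes "h \<in> half_edges D" "k \<in> half_edges D" "k \<noteq> h" "arc_of D k = arc_of D h"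
  shows "k = opposite D h"
  using paired assms opposite[OF assms(1)] unfolding paired_ends_def by metis

lemma opposite_opposite: "h \<in> half_edges D \<Longrightarrow> opposite D (opposite D h) = h"
  using opposite opposite_unique by metis

lemma half_edges_of_arc:
  assumes "h \<in> half_edges D"
  shows "{k \<in> half_edges D. arc_of D k = arc_of D h} = {h, opposite D h}"
  using assms opposite[OF assms] opposite_unique[OF assms] by blast

lemma turn_half_edge: "h \<in> half_edges D \<Longrightarrow> turn h \<in> half_edges D"
  by (auto simp: half_edges_def turn_def)

lemma same_side_iff: "same_side D h k \<longleftrightarrow> h \<in> half_edges D \<and> k = turn (opposite D h)"
proof
  assume "same_side D h k"
  then obtain r p s q where *: "(r, p) \<in> half_edges D" "(s, q) \<in> half_edges D" "(r, p) \<noteq> (s, q)"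
    "arc_at D r p = arc_at D s q" "h = (r, p)" "k = (s, (q + 3) mod 4)" unfolding same_side_def by blast
  then have "(s, q) = opposite D h" by (intro opposite_unique) (auto simp: arc_of_def)
  then have "turn (opposite D h) = turn (s, q)" by simp
  with * show "h \<in> half_edges D \<and> k = turn (opposite D h)" by (simp add: turn_def)
next
  assume h: "h \<in> half_edges D \<and> k = turn (opposite D h)"
  then show "same_side D h k"
    unfolding same_side_def using opposite[of h]
    by (intro exI[of _ "fst h"] exI[of _ "snd h"] exI[of _ "fst (opposite D h)"] exI[of _ "snd (opposite D h)"])
      (auto simp: arc_of_def turn_def)
qed

text \<open>
  What is on the right of an arc seen from one end is on the left of it seen from the other end.
\<close>

lemma face_turn:
  assumes f: "f \<in> invariant (half_edges D) (same_side D)" and h: "h \<in> half_edges D"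
  shows "f (turn h) = f (opposite D h)"
proof -
  have "same_side D (opposite D h) (turn h)"
    unfolding same_side_iff using opposite(1)[OF h] opposite_opposite[OF h] by simp
  with f show ?thesis unfolding invariant_def by (metis (mono_tags, lifting) mem_Collect_eq)
qed

text \<open>
  A 2-chain is a function on corners that is constant on faces. As a corner is the left side of its
  half-edge, summing over both ends of an arc takes each of its two sides once.
\<close>

definition boundary2 :: "(nat \<times> nat \<Rightarrow> bit) \<Rightarrow> 'e \<Rightarrow> bit" where
  "boundary2 f e = (\<Sum>h | h \<in> half_edges D \<and> arc_of D h = e. f h)"

definition boundary1 :: "('e \<Rightarrow> bit) \<Rightarrow> nat \<Rightarrow> bit" where
  "boundary1 w r = (if r < ncross D then \<Sum>p<4. w (arc_of D (r, p)) else 0)"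

definition adjacent :: "nat \<Rightarrow> nat \<Rightarrow> bool" where
  "adjacent r s \<longleftrightarrow> r < ncross D \<and> s < ncross D \<and>
        set (ends (crossings D ! r)) \<inter> set (ends (crossings D ! s)) \<noteq> {}"

lemma adjacent_iff: "adjacent r s \<longleftrightarrow>
    (\<exists>p q. (r, p) \<in> half_edges D \<and> (s, q) \<in> half_edges D \<and> arc_of D (r, p) = arc_of D (s, q))"
proof -
  have "x \<in> set (ends c) \<longleftrightarrow> (\<exists>p<4. x = ends c ! p)" for x and c :: "'e crossing"
    by (metis in_set_conv_nth length_ends)
  then show ?thesis unfolding adjacent_def disjoint_iff half_edges_def arc_of_def by auto
qed

lemma pieces_eq: "pieces D = generated_classes {..<ncross D} adjacent"
  unfolding pieces_def adjacent_def ..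

lemma boundary2_add: "boundary2 (f + g) = boundary2 f + boundary2 g"
  by (rule ext) (simp only: boundary2_def plus_fun_apply sum.distrib)

lemma boundary1_add: "boundary1 (f + g) = boundary1 f + boundary1 g"
proof
  fix r
  show "boundary1 (f + g) r = (boundary1 f + boundary1 g) r"
    by (cases "r < ncross D") (simp_all only: boundary1_def plus_fun_apply sum.distrib if_True if_False add_0_left)
qed

lemma boundary2_arc:
  assumes "h \<in> half_edges D"
  shows "boundary2 f (arc_of D h) = f h + f (opposite D h)"
  unfolding boundary2_def half_edges_of_arc[OF assms] using opposite(2)[OF assms] by simp

lemma sum_lessThan_4: "sum f {..<4::nat} = f 0 + f 1 + f 2 + (f 3 :: bit)"
  by (simp add: numeral_eq_Suc)

text \<open>
  Around a crossing every corner is counted twice, once for each of the two arc ends next to it.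
\<close>

lemma boundary_boundary:
  assumes f: "f \<in> invariant (half_edges D) (same_side D)"
  shows "boundary1 (boundary2 f) = 0"
proof
  fix r
  have "(\<Sum>p<4. boundary2 f (arc_of D (r, p))) = 0" if "r < ncross D"
  proof -
    have H: "(r, p) \<in> half_edges D" if "p < 4" for p
      using that \<open>r < ncross D\<close> by (simp add: half_edges_def)
    have sides: "boundary2 f (arc_of D (r, p)) = f (r, p) + f (turn (r, p))" if "p < 4" for p
      by (simp only: boundary2_arc H that face_turn[OF f])
    show ?thesis
      by (cases "f (r, 0)"; cases "f (r, 1)"; cases "f (r, 2)"; cases "f (r, 3)")
        (simp_all add: sum_lessThan_4 sides turn_def)
  qed
  then show "boundary1 (boundary2 f) r = 0 r" by (simp add: boundary1_def)
qed

text \<open>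
  A 2-cycle has equal values on the two sides of each arc. Going around a crossing and along the arcs,
  it is therefore determined by one value for each connected piece.
\<close>

lemma card_boundary2_kernel:
  "card {f \<in> invariant (half_edges D) (same_side D). boundary2 f = 0} \<le> 2 ^ card (pieces D)"
proof -
  let ?K = "{f \<in> invariant (half_edges D) (same_side D). boundary2 f = 0}"
  let ?C = "invariant {..<ncross D} adjacent"
  let ?lift = "\<lambda>g h. if h \<in> half_edges D then g (fst h) else (0::bit)"
  have sub: "?K \<subseteq> ?lift ` ?C"
  proof
    fix f assume "f \<in> ?K"
    then have f: "f \<in> invariant (half_edges D) (same_side D)" and b: "boundary2 f = 0" by auto
    have opp: "f h = f (opposite D h)" if "h \<in> half_edges D" for h
    proof -
      have "f h + f (opposite D h) = 0" using boundary2_arc[OF that, of f] b by simp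
      then show ?thesis by (cases "f h"; cases "f (opposite D h)") auto
    qed
    have turn: "f (turn h) = f h" if h: "h \<in> half_edges D" for h
      using opp[OF h] face_turn[OF f h] by simp
    have vertex: "f (r, p) = f (r, 0)" if "(r, p) \<in> half_edges D" for r p
    proof -
      have "r < ncross D" "p < 4" using that by (auto simp: half_edges_def)
      then have "f (r, 0) = f (r, 3)" "f (r, 3) = f (r, 2)" "f (r, 2) = f (r, 1)"
        using turn[of "(r, 0)"] turn[of "(r, 3)"] turn[of "(r, 2)"]
        by (auto simp: half_edges_def turn_def)
      moreover have "p = 0 \<or> p = 1 \<or> p = 2 \<or> p = 3" using \<open>p < 4\<close> by auto
      ultimately show ?thesis by auto
    qed
    define g where "g r = (if r < ncross D then f (r, 0) else 0)" for r
    have "g r = g s" if rs: "adjacent r s" for r s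
    proof -
      obtain p q where pq: "(r, p) \<in> half_edges D" "(s, q) \<in> half_edges D" "arc_of D (r, p) = arc_of D (s, q)"
        using rs by (auto simp: adjacent_iff)
      have "f (r, p) = f (s, q)"
      proof (cases "(s, q) = (r, p)")
        case False
        then have "(s, q) = opposite D (r, p)" using pq by (intro opposite_unique) auto
        with opp[OF pq(1)] show ?thesis by simp
      qed simp
      then show ?thesis
        using vertex[OF pq(1)] vertex[OF pq(2)] rs by (simp add: g_def adjacent_def)
    qed
    then have "g \<in> ?C" by (simp add: invariant_def supp_in_def g_def)
    moreover have "f = ?lift g"
    proof
      fix h show "f h = ?lift g h"
      proof (cases "h \<in> half_edges D")
        case True
        then show ?thesis using vertex[of "fst h" "snd h"] by (auto simp: g_def half_edges_def)
      next
        case False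
        have "\<forall>h. h \<notin> half_edges D \<longrightarrow> f h = 0" using f unfolding invariant_def supp_in_def by blast
        with False have "f h = 0" by blast
        with False show ?thesis by simp
      qed
    qed
    ultimately show "f \<in> ?lift ` ?C" by blast
  qed
  have C: "card ?C = 2 ^ card (pieces D)" "finite ?C"
    unfolding pieces_eq by (rule card_invariant; auto simp: adjacent_def)+
  have "card ?K \<le> card ?C" by (rule surj_card_le[OF C(2) sub])
  then show ?thesis using C by simp
qed

lemma boundary1_point:
  assumes h: "h \<in> half_edges D"
  shows "boundary1 (point (arc_of D h)) = point (fst h) + point (fst (opposite D h))"
proof
  fix r
  show "boundary1 (point (arc_of D h)) r = (point (fst h) + point (fst (opposite D h))) r"
  proof (cases "r < ncross D")
    case True
    let ?k = "opposite D h"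
    have k: "?k \<in> half_edges D" by (rule opposite[OF h])
    have "point (arc_of D h) (arc_of D (r, p)) = point h (r, p) + point ?k (r, p)" if p: "p < 4" for p
    proof -
      have "(r, p) \<in> half_edges D" using p True by (simp add: half_edges_def)
      then have "arc_of D (r, p) = arc_of D h \<longleftrightarrow> (r, p) = h \<or> (r, p) = ?k"
        using half_edges_of_arc[OF h] by blast
      then show ?thesis using opposite(2)[OF h] by (auto simp: point_def)
    qed
    then have "boundary1 (point (arc_of D h)) r = (\<Sum>p<4. point h (r, p)) + (\<Sum>p<4. point ?k (r, p))"
      using True by (simp only: boundary1_def if_True flip: sum.distrib) (intro sum.cong; simp)
    moreover have "(\<Sum>p<4. point l (r, p)) = point (fst l) r" if "l \<in> half_edges D" for l :: "nat \<times> nat"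
    proof -
      have "(\<Sum>p<4. point l (r, p)) = (\<Sum>p<4. if p = snd l then point (fst l) r else 0)"
        by (intro sum.cong) (auto simp: point_def prod_eq_iff)
      also have "\<dots> = point (fst l) r" using that by (auto simp: half_edges_def)
      finally show ?thesis .
    qed
    ultimately show ?thesis using h k by simp
  next
    case False
    then show ?thesis
      using h opposite(1)[OF h] by (auto simp: boundary1_def point_def half_edges_def)
  qed
qed

text \<open>
  Two crossings of the same piece are joined by a path of arcs, so their sum is a boundary. Modulo
  boundaries, every 0-chain is thus supported on one chosen crossing for each piece.
\<close>

lemma card_boundary1_image:
  "2 ^ ncross D \<le> card (boundary1 ` supp_in (edges D)) * 2 ^ card (pieces D)"
proof -
  let ?V = "{..<ncross D}" and ?B = "boundary1 ` supp_in (edges D)"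
  define rep where "rep C = (SOME s. s \<in> C)" for C :: "nat set"
  define R where "R = rep ` pieces D"
  have finP: "finite (pieces D)" by (simp add: pieces_eq generated_classes_eq)
  then have R: "finite R" "card R \<le> card (pieces D)" by (auto simp: R_def card_image_le)
  have B: "add_subgroup ?B"
    by (intro add_subgroup_image add_subgroup_supp_in boundary1_add)
  have B0: "point r + point r \<in> ?B" for r
    using B unfolding add_subgroup_def bit_fun_add_self by (rule conjunct1)
  have finB: "finite ?B"
    by (intro finite_imageI card_supp_in) (simp add: edges_eq)
  have path: "point r + point s \<in> ?B" if "equivclp adjacent r s" for r s
    using that
  proof (induction rule: equivclp_induct)
    case base
    show ?case by (rule B0)
  next
    case (step y z)
    have "point y + point z \<in> ?B"
    proof -
      have "adjacent y z" using step(2) by (auto simp: adjacent_def)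
      then obtain p q where pq: "(y, p) \<in> half_edges D" "(z, q) \<in> half_edges D" "arc_of D (y, p) = arc_of D (z, q)"
        by (auto simp: adjacent_iff)
      show ?thesis
      proof (cases "(z, q) = (y, p)")
        case True
        then have "z = y" by simp
        then show ?thesis using B0 by simp
      next
        case False
        then have "(z, q) = opposite D (y, p)" using pq by (intro opposite_unique) auto
        then have "boundary1 (point (arc_of D (y, p))) = point y + point z"
          using boundary1_point[OF pq(1)] by (metis fst_conv)
        moreover have "point (arc_of D (y, p)) \<in> supp_in (edges D)"
          using pq(1) by (auto simp: supp_in_def point_def edges_eq)
        ultimately show ?thesis by (metis image_eqI)
      qed
    qed
    then have "(point r + point y) + (point y + point z) \<in> ?B"
      using add_subgroup_add[OF B] step(3) by blast
    moreover have "(point r + point y) + (point y + point z) = point r + point z"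
      by (metis add.assoc add.right_neutral bit_fun_add_self)
    ultimately show ?case by (simp only:)
  qed
  \<comment> \<open>sums of a boundary and a chain on the representatives; these turn out to be all 0-chains\<close>
  define U where "U = (\<lambda>(b, f). b + f) ` (?B \<times> supp_in R)"
  have U: "add_subgroup U"
    unfolding U_def by (intro add_subgroup_sums B add_subgroup_supp_in)
  have "point r \<in> U" if r: "r \<in> ?V" for r
  proof -
    define C where "C = class_in ?V adjacent r"
    have "C \<in> pieces D" using r by (simp add: C_def pieces_eq generated_classes_eq)
    have "r \<in> C" using r by (simp add: C_def class_in_def)
    then have "rep C \<in> C" unfolding rep_def by (rule someI)
    then have "point r + point (rep C) \<in> ?B" by (intro path) (simp add: C_def class_in_def)
    moreover have "point (rep C) \<in> supp_in R"
      using \<open>C \<in> pieces D\<close> by (auto simp: R_def supp_in_def point_def)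
    moreover have "point r = (point r + point (rep C)) + point (rep C)"
      by (simp add: add.assoc bit_fun_add_self)
    ultimately show ?thesis unfolding U_def by (metis (mono_tags, lifting) SigmaI case_prod_conv image_eqI)
  qed
  then have "supp_in ?V \<subseteq> U" by (intro supp_in_subset U) auto
  moreover have "finite U" unfolding U_def using finB R(1) by (simp add: card_supp_in)
  ultimately have "card (supp_in ?V) \<le> card U" by (rule card_mono[rotated])
  also have "card U \<le> card (?B \<times> supp_in R)"
    unfolding U_def using finB R(1) by (intro card_image_le) (simp add: card_supp_in)
  also have "\<dots> = card ?B * 2 ^ card R" using R(1) by (simp add: card_cartesian_product card_supp_in)
  also have "\<dots> \<le> card ?B * 2 ^ card (pieces D)" using R(2) by simp
  finally show ?thesis by (simp add: card_supp_in)
qed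

text \<open>
  The bounds for the kernel of \<open>boundary2\<close> and for the image of \<open>boundary1\<close>, combined with Euler's
  formula, show that there are at least as many 1-boundaries as 1-cycles, so every 1-cycle is a
  boundary. The sum of all arcs is a 1-cycle, and the 2-chain that it bounds takes different
  values on the two sides of every arc.
\<close>

theorem planar_checkerboard:
  assumes planar: "planar D"
  shows "\<exists>W. checkerboard D W"
proof -
  let ?A2 = "invariant (half_edges D) (same_side D)" and ?A1 = "supp_in (edges D)"
  have "same_side D h k \<Longrightarrow> h \<in> half_edges D \<and> k \<in> half_edges D" for h k
    by (auto simp: same_side_iff intro: turn_half_edge opposite)
  then have A2: "card ?A2 = 2 ^ card (faces D)" "finite ?A2"
    unfolding faces_def by (rule card_invariant[OF finite_half_edges]; simp)+
  have A1: "card ?A1 = 2 ^ card (edges D)" "finite ?A1" by (simp_all add: card_supp_in edges_eq)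
  define Z where "Z = {w \<in> ?A1. boundary1 w = 0}"
  define B where "B = boundary2 ` ?A2"
  have "card ?A2 = card {f \<in> ?A2. boundary2 f = 0} * card B"
    unfolding B_def by (intro card_kernel_image add_subgroup_invariant A2 boundary2_add)
  then have 1: "2 ^ card (faces D) \<le> 2 ^ card (pieces D) * card B"
    using card_boundary2_kernel unfolding A2 by simp
  have "card ?A1 = card Z * card (boundary1 ` ?A1)"
    unfolding Z_def by (intro card_kernel_image add_subgroup_supp_in A1 boundary1_add)
  then have 2: "2 ^ card (edges D) = card Z * card (boundary1 ` ?A1)" unfolding A1 .
  have euler: "card (faces D) + ncross D = card (edges D) + card (pieces D) + card (pieces D)"
    using planar unfolding planar_def by linarith
  have "2 ^ (card (pieces D) + ncross D) * card Z
      \<le> 2 ^ card (pieces D) * (card Z * (card (boundary1 ` ?A1) * 2 ^ card (pieces D)))"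
    using card_boundary1_image by (simp add: power_add mult.commute mult.left_commute)
  also have "\<dots> = 2 ^ (card (faces D) + ncross D)"
    unfolding euler power_add 2 by (simp add: algebra_simps)
  also have "\<dots> \<le> 2 ^ (card (pieces D) + ncross D) * card B"
    using 1 by (simp add: power_add)
  finally have "card Z \<le> card B" by simp
  moreover have "B \<subseteq> Z"
  proof
    fix w assume "w \<in> B"
    then obtain f where f: "f \<in> ?A2" "w = boundary2 f" by (auto simp: B_def)
    have "w e = 0" if "e \<notin> edges D" for e
      using that unfolding f(2) boundary2_def edges_eq by (intro sum.neutral) auto
    then show "w \<in> Z" using boundary_boundary[OF f(1)] by (simp add: Z_def f(2) supp_in_def)
  qed
  ultimately have "B = Z" using A1(2) by (intro card_seteq) (auto simp: Z_def)
  moreover have "(\<lambda>e. of_bool (e \<in> edges D)) \<in> Z"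
    by (auto simp: Z_def supp_in_def boundary1_def fun_eq_iff sum_lessThan_4 edges_eq half_edges_def)
  ultimately obtain f where f: "f \<in> ?A2" "boundary2 f = (\<lambda>e. of_bool (e \<in> edges D))"
    by (auto simp: B_def)
  have opp: "f (opposite D h) = f h + 1" if h: "h \<in> half_edges D" for h
  proof -
    have "f h + f (opposite D h) = 1"
      using boundary2_arc[OF h, of f] h unfolding f(2) by (simp add: edges_eq)
    then show ?thesis by (cases "f h"; cases "f (opposite D h)") auto
  qed
  moreover have "f (turn h) = f (opposite D h)" if "h \<in> half_edges D" for h
    by (rule face_turn[OF f(1) that])
  ultimately have "checkerboard D (\<lambda>h. f h = 0)" unfolding checkerboard_def by simp
  then show ?thesis by blast
qed

end

section \<open>Orientations of the arcs of a diagram\<close>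

lemma distinct_concat_index:
  assumes "distinct (concat xss)" "r < length xss" "s < length xss"
    "p < length (xss ! r)" "q < length (xss ! s)" "xss ! r ! p = xss ! s ! q"
  shows "r = s \<and> p = q"
  using assms
proof (induction xss arbitrary: r s)
  case (Cons xs xss)
  have disj: "set xs \<inter> set (concat xss) = {}" and dist: "distinct xs" "distinct (concat xss)"
    using Cons.prems(1) by auto
  have mem: "xss ! i ! j \<in> set (concat xss)" if "i < length xss" "j < length (xss ! i)" for i j
    using that by (auto simp: set_concat intro!: bexI[of _ "xss ! i"])
  show ?case
  proof (cases r; cases s)
    assume "r = 0" "s = 0"
    with Cons.prems dist show ?thesis by (simp add: nth_eq_iff_index_eq)
  next
    fix s' assume rs: "r = 0" "s = Suc s'"
    with Cons.prems have "xs ! p \<in> set xs" "xs ! p \<in> set (concat xss)"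
      using mem[of s' q] nth_mem[of p xs] by simp_all
    with disj show ?thesis by blast
  next
    fix r' assume rs: "r = Suc r'" "s = 0"
    with Cons.prems have "xs ! q \<in> set xs" "xs ! q \<in> set (concat xss)"
      using mem[of r' p] nth_mem[of q xs] by simp_all
    with disj show ?thesis by blast
  next
    fix r' s' assume rs: "r = Suc r'" "s = Suc s'"
    with Cons.prems dist Cons.IH[of r' s'] show ?thesis by simp
  qed
qed simp

text \<open>
  The strands through a crossing are numbered by truth values: \<open>False\<close> is the under-strand and \<open>True\<close>
  the over-strand, which enters at \<open>in_pos c True\<close> and leaves at \<open>out_pos c True\<close>.
\<close>

fun in_pos :: "'e crossing \<Rightarrow> bool \<Rightarrow> nat" where
  "in_pos (Pos a b c d) k = (if k then 3 else 0)"
| "in_pos (Neg a b c d) k = (if k then 1 else 0)"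

fun out_pos :: "'e crossing \<Rightarrow> bool \<Rightarrow> nat" where
  "out_pos (Pos a b c d) k = (if k then 1 else 2)"
| "out_pos (Neg a b c d) k = (if k then 3 else 2)"

definition strand_in :: "'e diagram \<Rightarrow> nat \<Rightarrow> bool \<Rightarrow> 'e" where
  "strand_in D r k = arc_at D r (in_pos (crossings D ! r) k)"

definition strand_out :: "'e diagram \<Rightarrow> nat \<Rightarrow> bool \<Rightarrow> 'e" where
  "strand_out D r k = arc_at D r (out_pos (crossings D ! r) k)"

lemma incoming_nth: "ends c ! in_pos c k = incoming c ! of_bool k"
  by (cases c; cases k) auto

lemma outgoing_nth: "ends c ! out_pos c k = outgoing c ! of_bool k"
  by (cases c; cases k) auto

lemma length_incoming [simp]: "length (incoming c) = 2" "length (outgoing c) = 2"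
  by (cases c; simp)+

lemma pos_cases: "p < 4 \<Longrightarrow> (\<exists>k. p = in_pos c k) \<or> (\<exists>k. p = out_pos c k)"
proof -
  assume "p < 4"
  then have "p = 0 \<or> p = 1 \<or> p = 2 \<or> p = 3" by auto
  then show ?thesis by (cases c) (auto intro: exI[of _ True] exI[of _ False])
qed

lemma pos_less [simp]: "in_pos c k < 4" "out_pos c k < 4"
  by (cases c; simp)+

lemma in_pos_neq_out_pos: "in_pos c k \<noteq> out_pos c l"
  by (cases c) auto

lemma set_concat_index: "set (concat (map f xs)) = (\<lambda>(r, k). f (xs ! r) ! of_bool k) ` ({..<length xs} \<times> UNIV)"
  if "\<And>c. length (f c) = 2"
proof -
  have "set (f c) = (\<lambda>k. f c ! of_bool k) ` UNIV" for c
    using that[of c] by (auto simp: UNIV_bool numeral_2_eq_2 length_Suc_conv)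
  then have "set (concat (map f xs)) = (\<Union>c\<in>set xs. (\<lambda>k. f c ! of_bool k) ` UNIV)" by simp
  also have "\<dots> = (\<Union>r<length xs. (\<lambda>k. f (xs ! r) ! of_bool k) ` UNIV)"
    by (auto simp: set_conv_nth)
  also have "\<dots> = (\<lambda>(r, k). f (xs ! r) ! of_bool k) ` ({..<length xs} \<times> UNIV)" by auto
  finally show ?thesis .
qed

context
  fixes D :: "'e diagram"
  assumes D: "oriented_code D"
begin

lemma strand_in_eq: "strand_in D r k = incoming (crossings D ! r) ! of_bool k"
  by (simp add: strand_in_def incoming_nth)

lemma strand_out_eq: "strand_out D r k = outgoing (crossings D ! r) ! of_bool k"
  by (simp add: strand_out_def outgoing_nth)

lemma inj_strands:
  assumes "distinct (concat (map f (crossings D)))" and "\<And>c. length (f c) = 2"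
  shows "inj_on (\<lambda>(r, k). f (crossings D ! r) ! of_bool k) ({..<ncross D} \<times> UNIV)"
proof (rule inj_onI; clarify)
  fix r k s l assume *: "r < ncross D" "s < ncross D"
    and eq: "f (crossings D ! r) ! of_bool k = f (crossings D ! s) ! of_bool l"
  have "r = s \<and> (of_bool k :: nat) = of_bool l"
    by (rule distinct_concat_index[OF assms(1)]) (use * eq assms(2) in \<open>auto simp: ncross_def\<close>)
  then show "r = s \<and> k = l" by (cases k; cases l) auto
qed

lemma two_in_two_out_strands: "two_in_two_out (ncross D) (strand_in D) (strand_out D)"
proof
  show "inj_on (case_prod (strand_in D)) ({..<ncross D} \<times> UNIV)"
    unfolding strand_in_eq[abs_def] by (rule inj_strands) (use D in \<open>auto simp: oriented_code_def\<close>)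
  show "inj_on (case_prod (strand_out D)) ({..<ncross D} \<times> UNIV)"
    unfolding strand_out_eq[abs_def] by (rule inj_strands) (use D in \<open>auto simp: oriented_code_def\<close>)
  show "case_prod (strand_in D) ` ({..<ncross D} \<times> UNIV) = case_prod (strand_out D) ` ({..<ncross D} \<times> UNIV)"
    using D set_concat_index[of incoming "crossings D"] set_concat_index[of outgoing "crossings D"]
    unfolding strand_in_eq[abs_def] strand_out_eq[abs_def] oriented_code_def ncross_def by simp
qed

lemma half_edge_cases:
  assumes "h \<in> half_edges D"
  obtains r k where "r < ncross D" "h = (r, in_pos (crossings D ! r) k)" "arc_of D h = strand_in D r k"
  | r k where "r < ncross D" "h = (r, out_pos (crossings D ! r) k)" "arc_of D h = strand_out D r k"
proof -
  obtain r p where h: "h = (r, p)" "r < ncross D" "p < 4" using assms by (auto simp: half_edges_def)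
  from pos_cases[OF h(3), of "crossings D ! r"] show ?thesis
    using that h by (auto simp: arc_of_def strand_in_def strand_out_def)
qed

lemma strand_ends_arcs: "two_in_two_out.touched (ncross D) (strand_in D) \<subseteq> arcs D"
proof -
  interpret two_in_two_out "ncross D" "strand_in D" "strand_out D" by (rule two_in_two_out_strands)
  have "touched = set (concat (map incoming (crossings D)))"
    unfolding touched_def
    unfolding set_concat_index[of incoming, OF length_incoming(1)] strand_in_eq ncross_def ..
  then show ?thesis using D unfolding oriented_code_def by blast
qed

lemma arc_of_arcs:
  assumes "h \<in> half_edges D"
  shows "arc_of D h \<in> arcs D"
proof -
  interpret two_in_two_out "ncross D" "strand_in D" "strand_out D" by (rule two_in_two_out_strands)
  show ?thesis using assms strand_ends_arcs by (elim half_edge_cases) (auto intro: inc_touched out_touched)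
qed

text \<open>
  Every arc that meets a crossing has one end among the incoming and one among the outgoing ends.
\<close>

lemma paired_ends_oriented: "paired_ends D"
  unfolding paired_ends_def
proof
  interpret two_in_two_out "ncross D" "strand_in D" "strand_out D" by (rule two_in_two_out_strands)
  have in_H: "(r, in_pos (crossings D ! r) k) \<in> half_edges D"
    and out_H: "(r, out_pos (crossings D ! r) k) \<in> half_edges D" if "r < ncross D" for r k
    using that by (auto simp: half_edges_def)
  fix h assume "h \<in> half_edges D"
  then show "\<exists>!k. k \<in> half_edges D \<and> k \<noteq> h \<and> arc_of D k = arc_of D h"
  proof (cases rule: half_edge_cases)
    case (1 r k)
    have "strand_in D r k \<in> case_prod (strand_out D) ` ({..<ncross D} \<times> UNIV)"
      using inc_touched[OF 1(1)] unfolding touched_def same_ends .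
    then obtain s l where s: "s < ncross D" "strand_out D s l = strand_in D r k" by auto
    let ?k = "(s, out_pos (crossings D ! s) l)"
    have "?k \<in> half_edges D \<and> ?k \<noteq> h \<and> arc_of D ?k = arc_of D h"
      using s 1 out_H[OF s(1)] in_pos_neq_out_pos[of "crossings D ! r" k l]
      by (auto simp: arc_of_def strand_in_def strand_out_def)
    moreover have "j = ?k" if j: "j \<in> half_edges D" "j \<noteq> h" "arc_of D j = arc_of D h" for j
      using j(1)
    proof (cases rule: half_edge_cases)
      case (1 r' k')
      with j \<open>r < ncross D\<close> \<open>h = _\<close> \<open>arc_of D h = _\<close> show ?thesis by (auto simp: inc_eq_iff)
    next
      case (2 r' k')
      with j s \<open>arc_of D h = _\<close> have "strand_out D r' k' = strand_out D s l" by simp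
      then have "r' = s \<and> k' = l" unfolding out_eq_iff[OF 2(1) s(1)] .
      with 2 show ?thesis by simp
    qed
    ultimately show ?thesis by blast
  next
    case (2 r k)
    have "strand_out D r k \<in> case_prod (strand_in D) ` ({..<ncross D} \<times> UNIV)"
      using out_touched[OF 2(1)] unfolding touched_def .
    then obtain s l where s: "s < ncross D" "strand_in D s l = strand_out D r k" by auto
    let ?k = "(s, in_pos (crossings D ! s) l)"
    have "?k \<in> half_edges D \<and> ?k \<noteq> h \<and> arc_of D ?k = arc_of D h"
      using s 2 in_H[OF s(1)] in_pos_neq_out_pos[of "crossings D ! r" l k]
      by (auto simp: arc_of_def strand_in_def strand_out_def)
    moreover have "j = ?k" if j: "j \<in> half_edges D" "j \<noteq> h" "arc_of D j = arc_of D h" for j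
      using j(1)
    proof (cases rule: half_edge_cases)
      case (1 r' k')
      with j s \<open>arc_of D h = _\<close> have "strand_in D r' k' = strand_in D s l" by simp
      then have "r' = s \<and> k' = l" unfolding inc_eq_iff[OF 1(1) s(1)] .
      with 1 show ?thesis by simp
    next
      case (2 r' k')
      with j \<open>r < ncross D\<close> \<open>h = _\<close> \<open>arc_of D h = _\<close> show ?thesis by (auto simp: out_eq_iff)
    qed
    ultimately show ?thesis by blast
  qed
qed

end

lemma equivclp_eqI:
  assumes "\<And>x y. R x y \<Longrightarrow> R' x y \<or> R' y x" "\<And>x y. R' x y \<Longrightarrow> R x y \<or> R y x"
  shows "equivclp R = equivclp R'"
proof -
  have "symclp R = symclp R'" using assms by (auto simp: fun_eq_iff symclp_def)
  then show ?thesis unfolding equivclp_def by simp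
qed

lemma generated_classes_cong: "equivclp R = equivclp R' \<Longrightarrow> generated_classes S R = generated_classes S R'"
  by (simp add: generated_classes_def)

lemma ex_bool: "(\<exists>k. P k) \<longleftrightarrow> P False \<or> P True"
  by (metis (full_types))

lemma equivclp_strand_step:
  "equivclp (strand_step D) = equivclp (flow (ncross D) (strand_in D) (strand_out D) {})"
proof (rule equivclp_eqI)
  fix x y assume "strand_step D x y"
  then obtain r where r: "r < ncross D" "x = arc_at D r 0 \<and> y = arc_at D r 2 \<or> x = arc_at D r 1 \<and> y = arc_at D r 3"
    unfolding strand_step_def by blast
  then have "(\<exists>k. x = strand_in D r k \<and> y = strand_out D r k) \<or> (\<exists>k. y = strand_in D r k \<and> x = strand_out D r k)"
    unfolding ex_bool by (cases "crossings D ! r") (auto simp: strand_in_def strand_out_def)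
  then show "flow (ncross D) (strand_in D) (strand_out D) {} x y \<or> flow (ncross D) (strand_in D) (strand_out D) {} y x"
    unfolding flow_def using r(1) by auto
next
  fix x y assume "flow (ncross D) (strand_in D) (strand_out D) {} x y"
  then obtain r k where r: "r < ncross D" "x = strand_in D r k" "y = strand_out D r k"
    unfolding flow_def by auto
  then have "(x = arc_at D r 0 \<and> y = arc_at D r 2 \<or> x = arc_at D r 1 \<and> y = arc_at D r 3) \<or>
      (y = arc_at D r 0 \<and> x = arc_at D r 2 \<or> y = arc_at D r 1 \<and> x = arc_at D r 3)"
    by (cases "crossings D ! r"; cases k) (simp_all add: strand_in_def strand_out_def)
  then show "strand_step D x y \<or> strand_step D y x"
    unfolding strand_step_def using r(1) by blast
qed

definition smooth_at :: "'e diagram \<Rightarrow> nat set \<Rightarrow> nat \<Rightarrow> 'e \<Rightarrow> 'e \<Rightarrow> bool" where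
  "smooth_at D \<alpha> r e f \<longleftrightarrow>
     (if r \<in> \<alpha>
      then e = arc_at D r 0 \<and> f = arc_at D r 3 \<or> e = arc_at D r 1 \<and> f = arc_at D r 2
      else e = arc_at D r 0 \<and> f = arc_at D r 1 \<or> e = arc_at D r 2 \<and> f = arc_at D r 3)"

lemma smooth_step_iff: "smooth_step D \<alpha> e f \<longleftrightarrow> (\<exists>r<ncross D. smooth_at D \<alpha> r e f)"
  unfolding smooth_step_def smooth_at_def ..

text \<open>
  The vertex of the cube at which every crossing has its oriented smoothing; its circles are the
  Seifert circles.
\<close>

definition seifert :: "'e diagram \<Rightarrow> nat set" where
  "seifert D = {r. r < ncross D \<and> \<not> positive (crossings D ! r)}"

lemma card_seifert: "card (seifert D) = nneg D"
  by (simp add: seifert_def nneg_def ncross_def length_filter_conv_card)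

text \<open>
  The oriented smoothing at a crossing lets the two strands exchange their outgoing ends.
\<close>

lemma equivclp_smooth_seifert:
  "equivclp (smooth_step D (seifert D)) =
    equivclp (flow (ncross D) (strand_in D) (strand_out D) {..<ncross D})"
proof (rule equivclp_eqI)
  fix x y assume "smooth_step D (seifert D) x y"
  then obtain r where r: "r < ncross D" "smooth_at D (seifert D) r x y"
    unfolding smooth_step_iff by blast
  then have "(\<exists>k. x = strand_in D r k \<and> y = strand_out D r (k \<noteq> (r \<in> {..<ncross D}))) \<or>
      (\<exists>k. y = strand_in D r k \<and> x = strand_out D r (k \<noteq> (r \<in> {..<ncross D})))"
    unfolding ex_bool
    by (cases "crossings D ! r") (auto simp: smooth_at_def strand_in_def strand_out_def seifert_def)
  then show "flow (ncross D) (strand_in D) (strand_out D) {..<ncross D} x y \<or>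
      flow (ncross D) (strand_in D) (strand_out D) {..<ncross D} y x"
    unfolding flow_def using r(1) by blast
next
  fix x y assume "flow (ncross D) (strand_in D) (strand_out D) {..<ncross D} x y"
  then obtain r k where r: "r < ncross D" "x = strand_in D r k" "y = strand_out D r (\<not> k)"
    unfolding flow_def by auto
  then have "smooth_at D (seifert D) r x y \<or> smooth_at D (seifert D) r y x"
    by (cases "crossings D ! r"; cases k) (simp_all add: smooth_at_def strand_in_def strand_out_def seifert_def)
  then show "smooth_step D (seifert D) x y \<or> smooth_step D (seifert D) y x"
    unfolding smooth_step_iff using r(1) by blast
qed

text \<open>
  The orientation of the arcs given by a colouring \<open>W\<close>: an arc enters a crossing at those ends whose
  left corner is coloured, which are the ends 0 and 2 or the ends 1 and 3. The numbering by \<open>k\<close>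
  is such that the 0-smoothing connects the \<open>k\<close>-th incoming to the \<open>k\<close>-th outgoing end; the
  1-smoothing exchanges these connections.
\<close>

definition source_in :: "'e diagram \<Rightarrow> (nat \<times> nat \<Rightarrow> bool) \<Rightarrow> nat \<Rightarrow> bool \<Rightarrow> 'e" where
  "source_in D W r k = arc_at D r (if W (r, 0) then if k then 2 else 0 else if k then 3 else 1)"

definition source_out :: "'e diagram \<Rightarrow> (nat \<times> nat \<Rightarrow> bool) \<Rightarrow> nat \<Rightarrow> bool \<Rightarrow> 'e" where
  "source_out D W r k = arc_at D r (if W (r, 0) then if k then 3 else 1 else if k then 2 else 0)"

lemma equivclp_smooth_step:
  "equivclp (smooth_step D \<alpha>) = equivclp (flow (ncross D) (source_in D W) (source_out D W) \<alpha>)"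
proof (rule equivclp_eqI)
  fix x y assume "smooth_step D \<alpha> x y"
  then obtain r where r: "r < ncross D" "smooth_at D \<alpha> r x y"
    unfolding smooth_step_iff by blast
  then have "(\<exists>k. x = source_in D W r k \<and> y = source_out D W r (k \<noteq> (r \<in> \<alpha>))) \<or>
      (\<exists>k. y = source_in D W r k \<and> x = source_out D W r (k \<noteq> (r \<in> \<alpha>)))"
    unfolding ex_bool
    by (cases "r \<in> \<alpha>"; cases "W (r, 0)") (auto simp: smooth_at_def source_in_def source_out_def)
  then show "flow (ncross D) (source_in D W) (source_out D W) \<alpha> x y \<or>
      flow (ncross D) (source_in D W) (source_out D W) \<alpha> y x"
    unfolding flow_def using r(1) by blast
next
  fix x y assume "flow (ncross D) (source_in D W) (source_out D W) \<alpha> x y"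
  then obtain r k where r: "r < ncross D" "x = source_in D W r k" "y = source_out D W r (k \<noteq> (r \<in> \<alpha>))"
    unfolding flow_def by auto
  then have "smooth_at D \<alpha> r x y \<or> smooth_at D \<alpha> r y x"
    by (cases "r \<in> \<alpha>"; cases "W (r, 0)"; cases k) (simp_all add: smooth_at_def source_in_def source_out_def)
  then show "smooth_step D \<alpha> x y \<or> smooth_step D \<alpha> y x"
    unfolding smooth_step_iff using r(1) by blast
qed

text \<open>
  The two ends of an arc have left corners of different colours, so each arc leaves one crossing and
  enters one.
\<close>

lemma two_in_two_out_source:
  assumes P: "paired_ends D" and W: "checkerboard D W"
  shows "two_in_two_out (ncross D) (source_in D W) (source_out D W)"
proof -
  define ip where "ip r k = (if W (r, 0) then if k then 2 else 0 else if k then 3 else (1::nat))" for r k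
  define op where "op r k = (if W (r, 0) then if k then 3 else 1 else if k then 2 else (0::nat))" for r k
  have inc: "source_in D W r k = arc_of D (r, ip r k)" and out: "source_out D W r k = arc_of D (r, op r k)" for r k
    by (simp_all add: source_in_def source_out_def ip_def op_def arc_of_def)
  have H: "(r, ip r k) \<in> half_edges D" "(r, op r k) \<in> half_edges D" if "r < ncross D" for r k
    using that by (simp_all add: half_edges_def ip_def op_def)
  have alt: "W (r, 3) \<longleftrightarrow> \<not> W (r, 0)" "W (r, 2) \<longleftrightarrow> W (r, 0)" "W (r, 1) \<longleftrightarrow> \<not> W (r, 0)"
    if "r < ncross D" for r
  proof -
    have "W (turn (r, p)) \<noteq> W (r, p)" if "p < 4" for p
      using W that \<open>r < ncross D\<close> unfolding checkerboard_def by (auto simp: half_edges_def)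
    from this[of 0] this[of 3] this[of 2]
    show "W (r, 3) \<longleftrightarrow> \<not> W (r, 0)" "W (r, 2) \<longleftrightarrow> W (r, 0)" "W (r, 1) \<longleftrightarrow> \<not> W (r, 0)"
      by (auto simp: turn_def)
  qed
  have W_ip: "W (r, ip r k)" and W_op: "\<not> W (r, op r k)" if "r < ncross D" for r k
    using alt[OF that] by (auto simp: ip_def op_def)
  have ip_surj: "\<exists>k. p = ip r k" if "(r, p) \<in> half_edges D" "W (r, p)" for r p
  proof -
    have "r < ncross D" "p = 0 \<or> p = 1 \<or> p = 2 \<or> p = 3" using that(1) by (auto simp: half_edges_def)
    then show ?thesis using that(2) alt unfolding ip_def ex_bool by auto
  qed
  have op_surj: "\<exists>k. p = op r k" if "(r, p) \<in> half_edges D" "\<not> W (r, p)" for r p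
  proof -
    have "r < ncross D" "p = 0 \<or> p = 1 \<or> p = 2 \<or> p = 3" using that(1) by (auto simp: half_edges_def)
    then show ?thesis using that(2) alt unfolding op_def ex_bool by auto
  qed
  have W_opp: "W (opposite D h) \<longleftrightarrow> \<not> W h" if "h \<in> half_edges D" for h
    using W that unfolding checkerboard_def by blast
  have same: "h = k" if "h \<in> half_edges D" "k \<in> half_edges D" "arc_of D h = arc_of D k" "W h = W k" for h k
    using opposite_unique[OF P that(2,1)] W_opp[OF that(2)] that by auto
  have ip_inj: "ip r k = ip r l \<longleftrightarrow> k = l" and op_inj: "op r k = op r l \<longleftrightarrow> k = l" for r k l
    by (auto simp: ip_def op_def)
  show ?thesis
  proof
    show "inj_on (case_prod (source_in D W)) ({..<ncross D} \<times> UNIV)"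
    proof (rule inj_onI; clarify)
      fix r k s l assume rs: "r < ncross D" "s < ncross D" and "source_in D W r k = source_in D W s l"
      then have "(r, ip r k) = (s, ip s l)"
        by (intro same H) (auto simp: inc W_ip)
      then show "r = s \<and> k = l" using ip_inj by auto
    qed
    show "inj_on (case_prod (source_out D W)) ({..<ncross D} \<times> UNIV)"
    proof (rule inj_onI; clarify)
      fix r k s l assume rs: "r < ncross D" "s < ncross D" and "source_out D W r k = source_out D W s l"
      then have "(r, op r k) = (s, op s l)"
        by (intro same H) (auto simp: out W_op)
      then show "r = s \<and> k = l" using op_inj by auto
    qed
    show "case_prod (source_in D W) ` ({..<ncross D} \<times> UNIV) = case_prod (source_out D W) ` ({..<ncross D} \<times> UNIV)"
    proof (intro equalityI subsetI)
      fix e assume "e \<in> case_prod (source_in D W) ` ({..<ncross D} \<times> UNIV)"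
      then obtain r k where r: "r < ncross D" "e = arc_of D (r, ip r k)" by (auto simp: inc)
      obtain s q where s: "opposite D (r, ip r k) = (s, q)" by fastforce
      have sH: "(s, q) \<in> half_edges D" "arc_of D (s, q) = e" "\<not> W (s, q)"
        using opposite[OF P H(1)[OF r(1)], of k] W_opp[OF H(1)[OF r(1)], of k] W_ip[OF r(1)] r(2) unfolding s by auto
      from op_surj[OF sH(1,3)] obtain l where "q = op s l" by blast
      moreover have "s < ncross D" using sH(1) by (simp add: half_edges_def)
      ultimately show "e \<in> case_prod (source_out D W) ` ({..<ncross D} \<times> UNIV)"
        using sH(2) by (auto simp: out intro!: image_eqI[of _ _ "(s, l)"])
    next
      fix e assume "e \<in> case_prod (source_out D W) ` ({..<ncross D} \<times> UNIV)"
      then obtain r k where r: "r < ncross D" "e = arc_of D (r, op r k)" by (auto simp: out)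
      obtain s q where s: "opposite D (r, op r k) = (s, q)" by fastforce
      have sH: "(s, q) \<in> half_edges D" "arc_of D (s, q) = e" "W (s, q)"
        using opposite[OF P H(2)[OF r(1)], of k] W_opp[OF H(2)[OF r(1)], of k] W_op[OF r(1)] r(2) unfolding s by auto
      from ip_surj[OF sH(1,3)] obtain l where "q = ip s l" by blast
      moreover have "s < ncross D" using sH(1) by (simp add: half_edges_def)
      ultimately show "e \<in> case_prod (source_in D W) ` ({..<ncross D} \<times> UNIV)"
        using sH(2) by (auto simp: inc intro!: image_eqI[of _ _ "(s, l)"])
    qed
  qed
qed

section \<open>Circles, parity and degree\<close>

lemma joins_cong:
  assumes j: "joins R R' a c" and a: "equivclp R a a'" and c: "equivclp R c c'"
  shows "joins R R' a' c'"
proof -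
  have "equivclp R a' x \<longleftrightarrow> equivclp R a x" "equivclp R c' x \<longleftrightarrow> equivclp R c x" for x
    using a c by (blast intro: equivclp_trans equivclp_sym)+
  moreover have "equivclp R a' c' \<longleftrightarrow> equivclp R a c"
    using a c by (blast intro: equivclp_trans equivclp_sym)
  ultimately show ?thesis using j unfolding joins_def by simp
qed

lemma smooth_step_edges:
  assumes "r < ncross D"
  shows "r \<notin> \<alpha> \<Longrightarrow> equivclp (smooth_step D \<alpha>) (arc_at D r 0) (arc_at D r 1)"
    "r \<notin> \<alpha> \<Longrightarrow> equivclp (smooth_step D \<alpha>) (arc_at D r 2) (arc_at D r 3)"
    "r \<in> \<alpha> \<Longrightarrow> equivclp (smooth_step D \<alpha>) (arc_at D r 0) (arc_at D r 3)"
    "r \<in> \<alpha> \<Longrightarrow> equivclp (smooth_step D \<alpha>) (arc_at D r 1) (arc_at D r 2)"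
  by (rule equivclp_step; use assms in \<open>auto simp: smooth_step_def\<close>)+

context
  fixes D :: "'e diagram"
  assumes D: "link_diagram D"
begin

lemma oriented: "oriented_code D" and planar: "planar D"
  using D by (auto simp: link_diagram_def)

lemma finite_arcs: "finite (arcs D)"
  using oriented by (simp add: oriented_code_def)

lemma arc_at_arcs: "r < ncross D \<Longrightarrow> p < 4 \<Longrightarrow> arc_at D r p \<in> arcs D"
  using arc_of_arcs[OF oriented, of "(r, p)"] by (simp add: arc_of_def half_edges_def)

lemma finite_circles: "finite (circles D \<alpha>)"
  unfolding circles_def generated_classes_eq using finite_arcs by simp

lemma finite_states: "finite (states D)"
proof -
  have "finite (UNIV :: gen set)"
  proof -
    have "UNIV = {Gen1, GenX}" by (auto intro: gen.exhaust)
    then show ?thesis by (metis finite.emptyI finite.insertI)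
  qed
  then show ?thesis
    unfolding states_def by (intro finite_SigmaI finite_PiE finite_circles) auto
qed

text \<open>
  In the orientation given by a checkerboard colouring, changing the smoothing at \<open>r\<close> composes
  the permutation that follows the circles with the transposition of the two incoming arcs. These
  are the ends 0 and 2, or the ends 1 and 3; in the latter case each of them is joined by
  the smoothing to one of the ends 0 and 2.
\<close>

lemma smoothing_change:
  assumes r: "r < ncross D" "r \<notin> \<alpha>"
  shows "joins (smooth_step D \<alpha>) (smooth_step D (insert r \<alpha>)) (arc_at D r 0) (arc_at D r 2) \<or>
    joins (smooth_step D (insert r \<alpha>)) (smooth_step D \<alpha>) (arc_at D r 0) (arc_at D r 2)"
proof -
  have P: "paired_ends D" by (rule paired_ends_oriented[OF oriented])
  obtain W where W: "checkerboard D W" using planar_checkerboard[OF P planar] by blast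
  interpret two_in_two_out "ncross D" "source_in D W" "source_out D W"
    by (rule two_in_two_out_source[OF P W])
  let ?a = "source_in D W r False" and ?c = "source_in D W r True"
  have J: "joins (smooth_step D \<alpha>) (smooth_step D (insert r \<alpha>)) ?a ?c \<or>
    joins (smooth_step D (insert r \<alpha>)) (smooth_step D \<alpha>) ?a ?c"
    using joins_flow[OF r] unfolding joins_def equivclp_smooth_step[of D _ W] .
  show ?thesis
  proof (cases "W (r, 0)")
    case True
    then show ?thesis using J by (simp add: source_in_def)
  next
    case False
    then have "?a = arc_at D r 1" "?c = arc_at D r 3" by (simp_all add: source_in_def)
    with J consider "joins (smooth_step D \<alpha>) (smooth_step D (insert r \<alpha>)) (arc_at D r 1) (arc_at D r 3)"
      | "joins (smooth_step D (insert r \<alpha>)) (smooth_step D \<alpha>) (arc_at D r 1) (arc_at D r 3)" by metis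
    then show ?thesis
    proof cases
      case 1
      show ?thesis
        by (rule disjI1, rule joins_cong[OF 1]; rule equivclp_sym, rule smooth_step_edges) (use r in auto)
    next
      case 2
      have "joins (smooth_step D (insert r \<alpha>)) (smooth_step D \<alpha>) (arc_at D r 2) (arc_at D r 0)"
        by (rule joins_cong[OF 2 smooth_step_edges(4) equivclp_sym[OF smooth_step_edges(3)]])
          (use r in auto)
      then show ?thesis by (rule disjI2[OF joins_sym])
    qed
  qed
qed

text \<open>
  Each change of a smoothing changes the number of circles by one, so the number of circles plus
  \<open>|\<alpha>|\<close> has the same parity at all vertices of the cube. At the oriented smoothing it is related to the
  components by \<open>ncross D\<close> exchanges of outgoing ends, one at each crossing.
\<close>

lemma circles_parity:
  assumes "\<alpha> \<subseteq> {..<ncross D}"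
  shows "even (card (circles D \<alpha>) + card \<alpha> + npos D) \<longleftrightarrow> even (card (components D))"
proof -
  have base: "(\<lambda>r. arc_at D r 0) ` \<beta> \<subseteq> arcs D" "(\<lambda>r. arc_at D r 2) ` \<beta> \<subseteq> arcs D"
    if "\<beta> \<subseteq> {..<ncross D}" for \<beta>
    using that by (auto intro!: arc_at_arcs)
  have all: "even (card (circles D \<beta>) + card \<beta>) \<longleftrightarrow> even (card (circles D {}))" if "\<beta> \<subseteq> {..<ncross D}" for \<beta>
    unfolding circles_def
    by (rule card_classes_parity[OF _ finite_arcs base[OF that]])
      (use that smoothing_change finite_subset[OF that] in \<open>auto simp: subset_iff\<close>)
  interpret two_in_two_out "ncross D" "strand_in D" "strand_out D"
    by (rule two_in_two_out_strands[OF oriented])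
  have "even (card (circles D (seifert D)) + ncross D) \<longleftrightarrow> even (card (components D))"
    using card_flow_classes[OF finite_arcs strand_ends_arcs[OF oriented], of "{..<ncross D}"]
    unfolding circles_def components_def
      generated_classes_cong[OF equivclp_smooth_seifert] generated_classes_cong[OF equivclp_strand_step]
    by simp
  moreover have "ncross D = npos D + nneg D"
    unfolding ncross_def npos_def nneg_def by (simp add: sum_length_filter_compl)
  moreover have "seifert D \<subseteq> {..<ncross D}" by (auto simp: seifert_def)
  ultimately show ?thesis
    using all[OF assms] all[of "seifert D"] by (auto simp: card_seifert)
qed

lemma odd_gdeg: "odd (gdeg g)"
  by (cases g) auto

lemma even_sum_odd:
  fixes f :: "'a \<Rightarrow> int"
  assumes "finite A" "\<And>x. x \<in> A \<Longrightarrow> odd (f x)"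
  shows "even (sum f A) \<longleftrightarrow> even (card A)"
  using assms by (induction A rule: finite_induct) auto

text \<open>
  Both generators of \<open>A\<close> have odd degree, so the degree of a state has the parity of the number of circles.
\<close>

lemma qdeg_parity:
  assumes s: "s \<in> states D"
  shows "even (qdeg D s - int (card (components D) mod 2))"
proof -
  have "fst s \<subseteq> {..<ncross D}" using s by (auto simp: states_def)
  from circles_parity[OF this] have "even (int (card (circles D (fst s)) + card (fst s) + npos D)) \<longleftrightarrow> even (card (components D))"
    by simp
  moreover have "even (\<Sum>C\<in>circles D (fst s). gdeg (snd s C)) \<longleftrightarrow> even (card (circles D (fst s)))"
    by (intro even_sum_odd finite_circles odd_gdeg)
  ultimately show ?thesis unfolding qdeg_def hdeg_def by auto
qed

lemma m_coeff_degree: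
  "coeff (m_coeff uvar a b c) n \<noteq> 0 \<Longrightarrow> gdeg c + 1 = gdeg a + gdeg b + 2 * int n"
  by (cases a; cases b; cases c) (auto simp: coeff_pCons split: nat.splits if_splits)

lemma Delta_coeff_degree:
  "coeff (Delta_coeff uvar a b c) n \<noteq> 0 \<Longrightarrow> gdeg b + gdeg c + 1 = gdeg a + 2 * int n"
  by (cases a; cases b; cases c) (auto simp: coeff_pCons split: nat.splits if_splits)

lemma circle_of_eq: "circle_of D \<alpha> e = class_in (arcs D) (smooth_step D \<alpha>) e"
  by (simp add: circle_of_def class_in_def)

text \<open>
  The circles away from \<open>r\<close> keep their labels, so only the factors that \<open>m\<close> or \<open>\<Delta>\<close> acts on contribute; both
  maps lower the degree by one when \<open>u\<close> has degree \<open>-2\<close>.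
\<close>

lemma edge_coeff_degree:
  assumes r: "r < ncross D" "r \<notin> \<alpha>" and nz: "coeff (edge_coeff uvar D \<alpha> r v w) n \<noteq> 0"
  shows "(\<Sum>C\<in>circles D (insert r \<alpha>). gdeg (w C)) + 1 = (\<Sum>C\<in>circles D \<alpha>. gdeg (v C)) + 2 * int n"
proof -
  let ?a = "arc_at D r 0" and ?c = "arc_at D r 2" and ?\<beta> = "insert r \<alpha>"
  define P P' Q Q' where "P = circle_of D \<alpha> ?a" and "P' = circle_of D \<alpha> ?c"
    and "Q = circle_of D ?\<beta> ?a" and "Q' = circle_of D ?\<beta> ?c"
  note defs = P_def P'_def Q_def Q'_def
  have arcs: "?a \<in> arcs D" "?c \<in> arcs D" using r by (auto intro: arc_at_arcs)
  have agree: "\<forall>C \<in> circles D \<alpha> - {P, P'}. v C = w C"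
    and coeff: "coeff (if P \<noteq> P' then m_coeff uvar (v P) (v P') (w Q)
              else if Q \<noteq> Q' then Delta_coeff uvar (v P) (w Q) (w Q') else 0) n \<noteq> 0"
    using nz unfolding edge_coeff_def Let_def defs by (auto split: if_splits)
  from smoothing_change[OF r] show ?thesis
  proof
    assume "joins (smooth_step D \<alpha>) (smooth_step D ?\<beta>) ?a ?c"
    note J = joins_classes[OF this arcs, folded circle_of_eq circles_def, folded defs]
    let ?rest = "circles D \<alpha> - {P, P'}"
    have "circles D \<alpha> = insert P (insert P' ?rest)" using J(4,5) by auto
    then have "(\<Sum>C\<in>circles D \<alpha>. gdeg (v C)) = (\<Sum>C\<in>insert P (insert P' ?rest). gdeg (v C))" by (rule arg_cong)
    also have "\<dots> = gdeg (v P) + gdeg (v P') + (\<Sum>C\<in>?rest. gdeg (v C))"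
      using J(1) finite_circles by simp
    finally have \<alpha>: "(\<Sum>C\<in>circles D \<alpha>. gdeg (v C)) = gdeg (v P) + gdeg (v P') + (\<Sum>C\<in>?rest. gdeg (v C))" .
    have "(\<Sum>C\<in>circles D ?\<beta>. gdeg (w C)) = gdeg (w Q) + (\<Sum>C\<in>?rest. gdeg (w C))"
      unfolding J(7) J(2)[symmetric] using J(2,6) finite_circles by simp
    moreover have "(\<Sum>C\<in>?rest. gdeg (w C)) = (\<Sum>C\<in>?rest. gdeg (v C))"
      using agree by (intro sum.cong) auto
    moreover have "gdeg (w Q) + 1 = gdeg (v P) + gdeg (v P') + 2 * int n"
      using coeff J(1) by (intro m_coeff_degree) simp
    ultimately show ?thesis using \<alpha> by simp
  next
    assume "joins (smooth_step D ?\<beta>) (smooth_step D \<alpha>) ?a ?c"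
    note J = joins_classes[OF this arcs, folded circle_of_eq circles_def, folded defs]
    let ?rest = "circles D ?\<beta> - {Q, Q'}"
    have PP': "P = P'" using J(2,3) by simp
    have rest: "?rest = circles D \<alpha> - {P, P'}"
      unfolding PP'[symmetric] J(7) J(2)[symmetric] using J(2,6) by auto
    have "circles D ?\<beta> = insert Q (insert Q' ?rest)" using J(4,5) by auto
    then have "(\<Sum>C\<in>circles D ?\<beta>. gdeg (w C)) = (\<Sum>C\<in>insert Q (insert Q' ?rest). gdeg (w C))" by (rule arg_cong)
    also have "\<dots> = gdeg (w Q) + gdeg (w Q') + (\<Sum>C\<in>?rest. gdeg (w C))"
      using J(1) finite_circles by simp
    finally have \<beta>: "(\<Sum>C\<in>circles D ?\<beta>. gdeg (w C)) = gdeg (w Q) + gdeg (w Q') + (\<Sum>C\<in>?rest. gdeg (w C))" .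
    have "(\<Sum>C\<in>circles D \<alpha>. gdeg (v C)) = gdeg (v P) + (\<Sum>C\<in>?rest. gdeg (v C))"
      unfolding J(7) J(2)[symmetric] using J(2,6) finite_circles by simp
    moreover have "(\<Sum>C\<in>?rest. gdeg (w C)) = (\<Sum>C\<in>?rest. gdeg (v C))"
      using agree unfolding rest by (intro sum.cong) auto
    moreover have "gdeg (w Q) + gdeg (w Q') + 1 = gdeg (v P) + 2 * int n"
      using coeff J(1) PP' by (intro Delta_coeff_degree) simp
    ultimately show ?thesis using \<beta> by simp
  qed
qed

lemma homogeneous: "diff_homogeneous D"
  unfolding diff_homogeneous_def
proof (intro ballI allI impI)
  fix s t n assume s: "s \<in> states D" and "t \<in> states D" and nz: "coeff (diff_coeff uvar D s t) n \<noteq> 0"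
  then obtain r where r: "r < ncross D" "r \<notin> fst s" "fst t = insert r (fst s)"
    and c: "coeff (edge_coeff uvar D (fst s) r (snd s) (snd t)) n \<noteq> 0"
    unfolding diff_coeff_def coeff_sum by (metis (mono_tags, lifting) mem_Collect_eq sum.neutral)
  have "finite (fst s)" using s finite_subset by (fastforce simp: states_def)
  then have h: "hdeg D t = hdeg D s + 1" using r by (simp add: hdeg_def)
  with edge_coeff_degree[OF r(1,2) c] r(3) show "hdeg D t = hdeg D s + 1 \<and> qdeg D t = qdeg D s + 2 * int n"
    by (simp add: qdeg_def)
qed

end

theorem corollary4p6:
  fixes D :: "'e diagram" and i :: int
  assumes "link_diagram D"
  shows "isomorphic_spaces (BN_stable D i) (BN_filtered D i)"
  using homogeneous[OF assms] finite_states[OF assms] qdeg_parity[OF assms]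
  by (rule stable_filtered_isomorphic)

end
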